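(* Let $n\ge 2$, and let $E\subset\mathbb{R}^n$ be a compact $Q$-regular set with $0<Q<n$ such that $G=\mathbb{R}^n\setminus E$ is a uniform domain with uniformity constant $L>1$. Then for each $x\in G$ and sufficiently large $r>0$, $$c\,e^{Qr/L}\le \mathrm{vol}_k(B_k(x,r))\le C e^{Qr},$$ where $C<\infty$ depends only on the $Q$-regularity data of $E$ and $L$, and $c>0$ depends only on the $Q$-regularity data of $E$, $L$, and $d(x)$.
   Context: For a proper subdomain $G\subset\mathbb{R}^n$ write $d(z)=d(z,\partial G)$ for the Euclidean distance from $z\in G$ to $\partial G$. The quasihyperbolic distance is $k_G(x,y)=\inf_{\alpha}\int_\alpha \frac{|dz|}{d(z)}$, the infimum being over all rectifiable curves $\alpha$ in $G$ joining $x$ and $y$. The quasihyperbolic ball is $B_k(x,r)=\{z\in G: k_G(x,z)<r\}$. The quasihyperbolic volume of a Lebesgue measurable set $A\subset G$ is $\mathrm{vol}_k(A)=\int_A \frac{dm(z)}{d(z)^n}$, where $m$ is $n$-dimensional Lebesgue measure. A set $E\subset\mathbb{R}^n$ is $Q$-regular ($0<Q<n$) if there is a (Borel regular, outer) measure $\mu$ with $\operatorname{spt}(\mu)=E$ (the smallest closed set of full $\mu$-measure) and constants $0<\alpha\le\beta<\infty$ such that $\alpha r^Q\le\mu(B^n(x,r))\le\beta r^Q$ for all $x\in E$ and $0<r<\operatorname{diam}(E)$, where $B^n(x,r)$ is the open Euclidean ball. The $Q$-regularity data are $n,Q,\alpha,\beta$ and $\operatorname{diam}(E)$. A domain $G\subset\mathbb{R}^n$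 is uniform with uniformity constant $L>1$ if $k_G(x,y)\le L\log\big(1+|x-y|/\min\{d(x,\partial G),d(y,\partial G)\}\big)$ for all $x,y\in G$.
   Formalization: It is additionally assumed that diam(E) > 0: for a one-point set E the regularity condition is vacuous, the complement is uniform, and the quasihyperbolic volume of balls grows only linearly in r, so the lower bound fails. *)

theory Defs
  imports "HOL-Analysis.Analysis"
begin

subsection \<open>Rectifiable curves and integration with respect to arc length\<close>

text \<open>Curves are library paths, i.e. parametrized over \<open>{0..1}\<close>.\<close>

definition curve_length :: "(real \<Rightarrow> 'a::metric_space) \<Rightarrow> real \<Rightarrow> real \<Rightarrow> ennreal" where
  "curve_length \<gamma> a b =
     (SUP (t, N) \<in> {t::nat \<Rightarrow> real. mono t \<and> range t \<subseteq> {a..b}} \<times> (UNIV :: nat set).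
        \<Sum>i<N. ennreal (dist (\<gamma> (t i)) (\<gamma> (t (Suc i)))))"

definition rectifiable_curve :: "(real \<Rightarrow> 'a::metric_space) \<Rightarrow> bool" where
  "rectifiable_curve \<gamma> \<longleftrightarrow> path \<gamma> \<and> curve_length \<gamma> 0 1 < \<infinity>"

text \<open>
  The arc length parametrization of a rectifiable curve \<open>\<gamma>\<close> is the map on \<open>[0, length \<gamma>]\<close> whose
  composition with the length function \<open>s u = curve_length \<gamma> 0 u\<close> is \<open>\<gamma>\<close>. Where \<open>s\<close> is not
  injective, \<open>\<gamma>\<close> is constant, so the choice of preimage made by \<open>inv_into\<close> is immaterial.
\<close>

definition arclength_param :: "(real \<Rightarrow> 'a::metric_space) \<Rightarrow> real \<Rightarrow> 'a" where
  "arclength_param \<gamma> s = \<gamma> (inv_into {0..1} (\<lambda>u. enn2real (curve_length \<gamma> 0 u)) s)"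

definition arclength_integral :: "(real \<Rightarrow> 'a::metric_space) \<Rightarrow> ('a \<Rightarrow> real) \<Rightarrow> ennreal" where
  "arclength_integral \<gamma> f =
     (\<integral>\<^sup>+ s \<in> {0..enn2real (curve_length \<gamma> 0 1)}. ennreal (f (arclength_param \<gamma> s)) \<partial>lebesgue)"

subsection \<open>Quasihyperbolic geometry\<close>

definition proper_subdomain :: "'a::euclidean_space set \<Rightarrow> bool" where
  "proper_subdomain G \<longleftrightarrow> open G \<and> connected G \<and> G \<noteq> {} \<and> G \<noteq> UNIV"

definition bdist :: "'a::euclidean_space set \<Rightarrow> 'a \<Rightarrow> real" where
  "bdist G z = infdist z (frontier G)"

text \<open>The values of \<open>qh_dist\<close> are finite on a proper subdomain; \<open>ennreal\<close> only serves to give the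
  infimum the value \<open>\<infinity>\<close> if there is no curve.\<close>

definition qh_dist :: "'a::euclidean_space set \<Rightarrow> 'a \<Rightarrow> 'a \<Rightarrow> ennreal" where
  "qh_dist G x y =
     (INF \<gamma> \<in> {\<gamma>. rectifiable_curve \<gamma> \<and> path_image \<gamma> \<subseteq> G \<and> pathstart \<gamma> = x \<and> pathfinish \<gamma> = y}.
        arclength_integral \<gamma> (\<lambda>z. 1 / bdist G z))"

definition qh_ball :: "'a::euclidean_space set \<Rightarrow> 'a \<Rightarrow> real \<Rightarrow> 'a set" where
  "qh_ball G x r = {z \<in> G. qh_dist G x z < ennreal r}"

definition qh_volume :: "'a::euclidean_space set \<Rightarrow> 'a set \<Rightarrow> ennreal" where
  "qh_volume G A = (\<integral>\<^sup>+ z \<in> A. ennreal (1 / bdist G z ^ DIM('a)) \<partial>lebesgue)"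

definition uniform_domain :: "real \<Rightarrow> 'a::euclidean_space set \<Rightarrow> bool" where
  "uniform_domain L G \<longleftrightarrow> proper_subdomain G \<and> 1 < L \<and>
     (\<forall>x\<in>G. \<forall>y\<in>G. qh_dist G x y \<le> ennreal (L * ln (1 + dist x y / min (bdist G x) (bdist G y))))"

subsection \<open>Regular sets\<close>

text \<open>\<open>lambda_system UNIV UNIV \<mu>\<close> consists of the Caratheodory measurable sets of \<open>\<mu>\<close>.\<close>

definition borel_regular_outer_measure :: "('a::topological_space set \<Rightarrow> ennreal) \<Rightarrow> bool" where
  "borel_regular_outer_measure \<mu> \<longleftrightarrow>
     outer_measure_space UNIV \<mu> \<and>
     sets borel \<subseteq> lambda_system UNIV UNIV \<mu> \<and>
     (\<forall>A. \<exists>B \<in> sets borel. A \<subseteq> B \<and> \<mu> B = \<mu> A)"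

definition is_spt :: "('a::topological_space set \<Rightarrow> ennreal) \<Rightarrow> 'a set \<Rightarrow> bool" where
  "is_spt \<mu> E \<longleftrightarrow> closed E \<and> \<mu> (- E) = 0 \<and> (\<forall>F. closed F \<and> \<mu> (- F) = 0 \<longrightarrow> E \<subseteq> F)"

text \<open>For unbounded \<open>E\<close> the diameter is infinite, and \<^const>\<open>diameter\<close> has no meaning.\<close>

definition regular_set :: "real \<Rightarrow> real \<Rightarrow> real \<Rightarrow> 'a::euclidean_space set \<Rightarrow> bool" where
  "regular_set Q \<alpha> \<beta> E \<longleftrightarrow>
     0 < Q \<and> Q < DIM('a) \<and> 0 < \<alpha> \<and> \<alpha> \<le> \<beta> \<and>
     (\<exists>\<mu>. borel_regular_outer_measure \<mu> \<and> is_spt \<mu> E \<and>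
        (\<forall>x\<in>E. \<forall>r>0. (bounded E \<longrightarrow> r < diameter E) \<longrightarrow>
           ennreal (\<alpha> * r powr Q) \<le> \<mu> (ball x r) \<and> \<mu> (ball x r) \<le> ennreal (\<beta> * r powr Q)))"

end

theory Submission
  imports Defs "HOL-Real_Asymp.Real_Asymp"
begin

text \<open>
  Write \<open>d(z)\<close> for the distance to \<open>E\<close>; regularity makes \<open>E\<close> a null set, so this is also the distance to
  the boundary. All volumes are obtained from the measure \<open>\<mu>\<close> by Tonelli's theorem applied to
  \<open>\<integral> f(z) \<mu>(B(z, \<rho>(z))) dz\<close>.

  Lower bound: uniformity puts the shell \<open>{z. s \<le> d(z) < K s}\<close> into the ball of radius \<open>r\<close> as soon as
  \<open>s\<close> is a large multiple of \<open>exp (-r/L)\<close>. Since \<open>{d < s}\<close> has volume comparable to \<open>s powr (n - Q)\<close>, for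
  large \<open>K\<close> the shell has quasihyperbolic volume at least of order \<open>s powr -Q\<close>.

  Upper bound: estimating the quasihyperbolic length near both endpoints of a curve gives
  \<open>|x - z|\<^sup>2 \<le> 9 d(x) d(z) exp r\<close> on the ball of radius \<open>r\<close>. Near \<open>E\<close> one has
  \<open>d(z) powr -n \<le> \<alpha>\<inverse> d(z) powr -(n + Q) \<mu>(B(z, 2 d(z)))\<close>, and Tonelli reduces the volume to the integral over
  \<open>w \<in> E\<close> of the tails \<open>\<integral> |z - w| powr -(n + Q) dz\<close> over \<open>|z - w| \<ge> |w - x|\<^sup>2 exp (-r) / (36 d(x))\<close>.
\<close>

subsection \<open>Length of curves and quasihyperbolic distance\<close>

text \<open>Appending \<open>u\<close> and \<open>v\<close> to a partition of \<open>{a..u}\<close>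
  gains the last chord. The inequality carries both the monotonicity of length and the bound of
  chords by differences of length.\<close>

lemma curve_length_extend:
  fixes \<gamma> :: "real \<Rightarrow> 'a::metric_space"
  assumes "a \<le> u" "u \<le> v"
  shows "curve_length \<gamma> a u + ennreal (dist (\<gamma> u) (\<gamma> v)) \<le> curve_length \<gamma> a v"
proof -
  have "(\<Sum>i<N. ennreal (dist (\<gamma> (t i)) (\<gamma> (t (Suc i))))) + ennreal (dist (\<gamma> u) (\<gamma> v)) \<le> curve_length \<gamma> a v"
    if t: "mono t" "range t \<subseteq> {a..u}" for t :: "nat \<Rightarrow> real" and N :: nat
  proof -
    \<comment> \<open>Partitions are infinite monotone sequences of which finitely many terms are
      read, so \<open>t'\<close> stays at \<open>v\<close> from \<open>Suc (Suc N)\<close> on. Of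
      the two extra chords, the one from \<open>t N\<close> to \<open>u\<close> is dropped at the
      end.\<close>
    define t' where "t' i = (if i \<le> N then t i else if i = Suc N then u else v)" for i
    have tu: "a \<le> t i" "t i \<le> u" for i using t(2) by (auto simp: image_subset_iff)
    have "mono t'"
      unfolding mono_def t'_def using assms tu monoD[OF t(1)] by (auto intro: order_trans)
    moreover have "range t' \<subseteq> {a..v}"
      using assms tu order_trans[OF tu(2) assms(2)] by (auto simp: t'_def)
    ultimately have "(\<Sum>i<Suc (Suc N). ennreal (dist (\<gamma> (t' i)) (\<gamma> (t' (Suc i))))) \<le> curve_length \<gamma> a v"
      unfolding curve_length_def
      by (intro SUP_upper2[of "(t', Suc (Suc N))"]) (simp_all del: sum.lessThan_Suc sum_ennreal)
    moreover have "(\<Sum>i<N. ennreal (dist (\<gamma> (t' i)) (\<gamma> (t' (Suc i))))) =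
        (\<Sum>i<N. ennreal (dist (\<gamma> (t i)) (\<gamma> (t (Suc i)))))"
      by (intro sum.cong) (auto simp: t'_def)
    moreover have "t' (Suc N) = u" "t' (Suc (Suc N)) = v" by (auto simp: t'_def)
    ultimately have "(\<Sum>i<N. ennreal (dist (\<gamma> (t i)) (\<gamma> (t (Suc i))))) + ennreal (dist (\<gamma> (t' N)) (\<gamma> u))
        + ennreal (dist (\<gamma> u) (\<gamma> v)) \<le> curve_length \<gamma> a v"
      by (simp add: sum.lessThan_Suc)
    then show ?thesis
      by (rule order_trans[rotated]) (intro add_right_mono add_increasing2; simp)
  qed
  moreover have "mono (\<lambda>_::nat. a) \<and> range (\<lambda>_::nat. a) \<subseteq> {a..u}"
    using assms by (auto simp: mono_def)
  then have "{t::nat \<Rightarrow> real. mono t \<and> range t \<subseteq> {a..u}} \<times> (UNIV :: nat set) \<noteq> {}" by blast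
  ultimately show ?thesis
    unfolding curve_length_def[of _ a u]
    by (subst ennreal_SUP_add_left[symmetric]) (auto intro!: SUP_least)
qed

section \<open>Length function and arc length parametrization\<close>

context
  fixes \<gamma> :: "real \<Rightarrow> 'a::metric_space"
  assumes rect: "rectifiable_curve \<gamma>"
begin

abbreviation len :: "real \<Rightarrow> real" where "len u \<equiv> enn2real (curve_length \<gamma> 0 u)"

lemma ennreal_len:
  assumes "0 \<le> u" "u \<le> 1" shows "ennreal (len u) = curve_length \<gamma> 0 u"
proof -
  have "curve_length \<gamma> 0 u \<le> curve_length \<gamma> 0 1"
    by (rule order_trans[OF _ curve_length_extend[of 0 u 1 \<gamma>]]) (use assms in \<open>auto intro: add_increasing2\<close>)
  then show ?thesis
    using rect by (auto simp: rectifiable_curve_def intro!: ennreal_enn2real)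
qed

lemma len_extend:
  assumes "0 \<le> u" "u \<le> v" "v \<le> 1" shows "len u + dist (\<gamma> u) (\<gamma> v) \<le> len v"
proof -
  have "ennreal (len u + dist (\<gamma> u) (\<gamma> v)) \<le> ennreal (len v)"
    using curve_length_extend[of 0 u v \<gamma>] assms by (simp add: ennreal_plus ennreal_len)
  then show ?thesis by (subst (asm) ennreal_le_iff) auto
qed

lemma len_sum:
  fixes p :: "nat \<Rightarrow> real"
  assumes "mono p" "range p \<subseteq> {0..1}"
  shows "len (p 0) + (\<Sum>i<N. dist (\<gamma> (p i)) (\<gamma> (p (Suc i)))) \<le> len (p N)"
proof (induction N)
  case (Suc N)
  have "len (p N) + dist (\<gamma> (p N)) (\<gamma> (p (Suc N))) \<le> len (p (Suc N))"
    using assms by (intro len_extend) (auto simp: mono_def image_subset_iff)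
  with Suc show ?case by simp
qed simp

lemma len_0: "len 0 = 0"
proof -
  have "curve_length \<gamma> 0 0 \<le> 0"
    unfolding curve_length_def
  proof (rule SUP_least, clarify)
    fix t :: "nat \<Rightarrow> real" and N :: nat assume "range t \<subseteq> {0..0}"
    then have "t i = 0" for i by auto
    then show "(\<Sum>i<N. ennreal (dist (\<gamma> (t i)) (\<gamma> (t (Suc i))))) \<le> 0" by simp
  qed
  then show ?thesis by simp
qed

text \<open>A partition whose chord sum comes within \<open>e/2\<close> of the total length is
  clipped to \<open>{0..u}\<close>, \<open>{u..v}\<close> and \<open>{v..1}\<close>. By
  \<open>len_sum\<close> the outer pieces contribute at most \<open>len u\<close> and
  \<open>len 1 - len v\<close>; by uniform continuity of \<open>\<gamma>\<close> the middle one
  contributes at most \<open>e/2\<close>. Hence \<open>len v - len u < e\<close>.\<close>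

lemma continuous_on_len: "continuous_on {0..1} len"
proof -
  have key: "\<exists>\<eta>>0. \<forall>u v. 0 \<le> u \<longrightarrow> u \<le> v \<longrightarrow> v \<le> 1 \<longrightarrow> v - u < \<eta> \<longrightarrow> len v - len u < e" if "e > 0" for e :: real
  proof -
    have "len 1 - e/2 < len 1" using \<open>e > 0\<close> by simp
    \<comment> \<open>\<open>ennreal\<close> sends a negative \<open>len 1 - e/2\<close> to 0, so
      the strict inequality can fail for a short curve; there the empty sum already serves.\<close>
    then have "ennreal (len 1 - e/2) < curve_length \<gamma> 0 1 \<or> len 1 < e/2"
      using ennreal_len[of 1] \<open>e > 0\<close> ennreal_lessI[of "len 1" "len 1 - e/2"] by (cases "len 1 < e/2") auto
    then obtain t :: "nat \<Rightarrow> real" and N where t: "mono t" "range t \<subseteq> {0..1}"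
      and big: "len 1 - e/2 < (\<Sum>i<N. dist (\<gamma> (t i)) (\<gamma> (t (Suc i))))"
    proof (elim disjE)
      assume "len 1 < e/2"
      then show thesis using that[of "\<lambda>_. 0" 0] by (simp add: mono_def)
    next
      assume "ennreal (len 1 - e/2) < curve_length \<gamma> 0 1"
      then obtain t :: "nat \<Rightarrow> real" and N where "mono t" "range t \<subseteq> {0..1}"
        "ennreal (len 1 - e/2) < (\<Sum>i<N. ennreal (dist (\<gamma> (t i)) (\<gamma> (t (Suc i)))))"
        unfolding curve_length_def less_SUP_iff by auto
      moreover from this(3) have "\<not> (\<Sum>i<N. dist (\<gamma> (t i)) (\<gamma> (t (Suc i)))) \<le> len 1 - e/2"
        using ennreal_leI[of "\<Sum>i<N. dist (\<gamma> (t i)) (\<gamma> (t (Suc i)))" "len 1 - e/2"]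
        by (auto simp: sum_ennreal dest: leD)
      ultimately show thesis by (intro that[of t N]) auto
    qed
    have uc: "uniformly_continuous_on {0..1} \<gamma>"
      using rect compact_uniformly_continuous[of "{0..1}" \<gamma>] by (simp add: rectifiable_curve_def path_def)
    \<comment> \<open>Up to \<open>N\<close> middle chords must add up to at most
      \<open>e/2\<close>; the \<open>+ 1\<close> covers \<open>N = 0\<close>.\<close>
    have ep: "e / (2 * (real N + 1)) > 0" using \<open>e > 0\<close> by simp
    obtain \<eta> where \<eta>: "\<eta> > 0"
      "\<And>a b. a \<in> {0..1} \<Longrightarrow> b \<in> {0..1} \<Longrightarrow> dist b a < \<eta> \<Longrightarrow> dist (\<gamma> b) (\<gamma> a) < e / (2 * (real N + 1))"
      using uc ep by (rule uniformly_continuous_onE) blast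
    have "len v - len u < e" if uv: "0 \<le> u" "u \<le> v" "v \<le> 1" "v - u < \<eta>" for u v
    proof -
      \<comment> \<open>The three clippings: \<open>c\<close> to \<open>{u..v}\<close>,
        \<open>l\<close> below \<open>u\<close>, \<open>h\<close> above \<open>v\<close>. Values of
        \<open>c\<close> differ by at most \<open>v - u < \<eta>\<close>.\<close>
      define c where "c a = max u (min v a)" for a
      define l where "l i = min u (t i)" for i
      define h where "h i = max v (t i)" for i
      have tt: "0 \<le> t i" "t i \<le> 1" "t i \<le> t (Suc i)" for i using t by (auto simp: mono_def image_subset_iff)
      have "(\<Sum>i<N. dist (\<gamma> (t i)) (\<gamma> (t (Suc i)))) \<le>
         (\<Sum>i<N. dist (\<gamma> (l i)) (\<gamma> (l (Suc i))) + dist (\<gamma> (c (t i))) (\<gamma> (c (t (Suc i))))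
                + dist (\<gamma> (h i)) (\<gamma> (h (Suc i))))"
      proof (rule sum_mono)
        fix i
        define a where "a = t i"
        define b where "b = t (Suc i)"
        have "a \<le> b" using tt(3) by (simp add: a_def b_def)
        then consider "b \<le> u" | "a \<le> u" "u \<le> b" "b \<le> v" | "a \<le> u" "v \<le> b" | "u \<le> a" "b \<le> v"
          | "u \<le> a" "a \<le> v" "v \<le> b" | "v \<le> a" by linarith
        then have "dist (\<gamma> a) (\<gamma> b) \<le> dist (\<gamma> (min u a)) (\<gamma> (min u b))
           + dist (\<gamma> (max u (min v a))) (\<gamma> (max u (min v b))) + dist (\<gamma> (max v a)) (\<gamma> (max v b))"
        proof cases
          case 3
          have "dist (\<gamma> a) (\<gamma> b) \<le> dist (\<gamma> a) (\<gamma> u) + dist (\<gamma> u) (\<gamma> v) + dist (\<gamma> v) (\<gamma> b)"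
            using dist_triangle[of "\<gamma> a" "\<gamma> b" "\<gamma> u"] dist_triangle[of "\<gamma> u" "\<gamma> b" "\<gamma> v"] by linarith
          with 3 uv(2) show ?thesis by (simp add: min.absorb1 min.absorb2 max.absorb1 max.absorb2)
        qed (use uv(2) \<open>a \<le> b\<close> dist_triangle[of "\<gamma> a" "\<gamma> b" "\<gamma> u"] dist_triangle[of "\<gamma> a" "\<gamma> b" "\<gamma> v"] in
              \<open>simp_all add: min.absorb1 min.absorb2 max.absorb1 max.absorb2\<close>)
        then show "dist (\<gamma> (t i)) (\<gamma> (t (Suc i))) \<le> dist (\<gamma> (l i)) (\<gamma> (l (Suc i)))
           + dist (\<gamma> (c (t i))) (\<gamma> (c (t (Suc i)))) + dist (\<gamma> (h i)) (\<gamma> (h (Suc i)))"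
          by (simp add: a_def b_def l_def c_def h_def)
      qed
      also have "\<dots> = (\<Sum>i<N. dist (\<gamma> (l i)) (\<gamma> (l (Suc i))))
          + (\<Sum>i<N. dist (\<gamma> (c (t i))) (\<gamma> (c (t (Suc i))))) + (\<Sum>i<N. dist (\<gamma> (h i)) (\<gamma> (h (Suc i))))"
        by (simp add: sum.distrib)
      also have "\<dots> \<le> len u + e/2 + (len 1 - len v)"
      proof (intro add_mono)
        have "mono l" "mono h" using t(1) unfolding mono_def l_def h_def by (metis min.mono order_refl, metis max.mono order_refl)
        moreover have "range l \<subseteq> {0..1}" "range h \<subseteq> {0..1}" using tt uv unfolding l_def h_def
          by (force simp: min_def max_def)+
        ultimately have "len (l 0) + (\<Sum>i<N. dist (\<gamma> (l i)) (\<gamma> (l (Suc i)))) \<le> len (l N)"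
           "len (h 0) + (\<Sum>i<N. dist (\<gamma> (h i)) (\<gamma> (h (Suc i)))) \<le> len (h N)"
          using len_sum by blast+
        moreover have mon: "len a \<le> len b" if "0 \<le> a" "a \<le> b" "b \<le> 1" for a b
          using len_extend[OF that] zero_le_dist[of "\<gamma> a" "\<gamma> b"] by linarith
        moreover have "len (l N) \<le> len u" "len v \<le> len (h 0)" "len (h N) \<le> len 1"
          using uv tt by (auto simp: l_def h_def intro!: mon)
        ultimately show "(\<Sum>i<N. dist (\<gamma> (l i)) (\<gamma> (l (Suc i)))) \<le> len u"
          "(\<Sum>i<N. dist (\<gamma> (h i)) (\<gamma> (h (Suc i)))) \<le> len 1 - len v"
          using enn2real_nonneg[of "curve_length \<gamma> 0 (l 0)"] by linarith+
        have "(\<Sum>i<N. dist (\<gamma> (c (t i))) (\<gamma> (c (t (Suc i))))) \<le> (\<Sum>i<N. e / (2 * (real N + 1)))"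
          using uv by (intro sum_mono less_imp_le \<eta>(2)) (auto simp: c_def dist_real_def)
        also have "\<dots> \<le> e/2" using \<open>e > 0\<close> by (simp add: field_simps)
        finally show "(\<Sum>i<N. dist (\<gamma> (c (t i))) (\<gamma> (c (t (Suc i))))) \<le> e/2" .
      qed
      finally show ?thesis using big by linarith
    qed
    with \<eta>(1) show ?thesis by blast
  qed
  show ?thesis
    unfolding continuous_on_iff
  proof (intro ballI allI impI)
    fix a e :: real assume a: "a \<in> {0..1}" "e > 0"
    obtain \<eta> where \<eta>: "\<eta> > 0" "\<And>u v. 0 \<le> u \<Longrightarrow> u \<le> v \<Longrightarrow> v \<le> 1 \<Longrightarrow> v - u < \<eta> \<Longrightarrow> len v - len u < e"
      using key[OF a(2)] by blast
    show "\<exists>d>0. \<forall>b\<in>{0..1}. dist b a < d \<longrightarrow> dist (len b) (len a) < e"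
    proof (intro exI[of _ \<eta>] conjI ballI impI \<eta>(1))
      fix b assume b: "b \<in> {0..1}" "dist b a < \<eta>"
      have "len u \<le> len v" if "0 \<le> u" "u \<le> v" "v \<le> 1" for u v
        using len_extend[OF that] zero_le_dist[of "\<gamma> u" "\<gamma> v"] by linarith
      then show "dist (len b) (len a) < e"
        using \<eta>(2)[of a b] \<eta>(2)[of b a] a b by (cases "a \<le> b") (auto simp: dist_real_def)
    qed
  qed
qed

text \<open>By the intermediate value theorem \<open>s\<close> lies in the range of
  \<open>len\<close>, so \<open>inv_into\<close> returns a genuine preimage.\<close>

lemma arclength_paramE:
  assumes "0 \<le> s" "s \<le> len 1"
  obtains u where "u \<in> {0..1}" "len u = s" "arclength_param \<gamma> s = \<gamma> u"
proof -
  obtain u where "0 \<le> u" "u \<le> 1" "len u = s"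
    using IVT'[of len 0 s 1] continuous_on_len assms len_0 by auto
  then have "s \<in> len ` {0..1}" by force
  then have "inv_into {0..1} len s \<in> {0..1}" "len (inv_into {0..1} len s) = s"
    by (rule inv_into_into, rule f_inv_into_f)
  then show thesis
    using that unfolding arclength_param_def by blast
qed

lemma dist_arclength_param:
  assumes "0 \<le> s" "s \<le> len 1"
  shows "dist (pathstart \<gamma>) (arclength_param \<gamma> s) \<le> s"
    and "dist (arclength_param \<gamma> s) (pathfinish \<gamma>) \<le> len 1 - s"
    and "arclength_param \<gamma> s \<in> path_image \<gamma>"
proof -
  obtain u where u: "u \<in> {0..1}" "len u = s" "arclength_param \<gamma> s = \<gamma> u"
    using arclength_paramE[OF assms] .
  show "dist (pathstart \<gamma>) (arclength_param \<gamma> s) \<le> s"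
    using len_extend[of 0 u] u len_0 by (simp add: pathstart_def)
  show "dist (arclength_param \<gamma> s) (pathfinish \<gamma>) \<le> len 1 - s"
    using len_extend[of u 1] u by (simp add: pathfinish_def)
  show "arclength_param \<gamma> s \<in> path_image \<gamma>"
    using u by (auto simp: path_image_def)
qed

lemma dist_le_len: "dist (pathstart \<gamma>) (pathfinish \<gamma>) \<le> len 1"
  using len_extend[of 0 1] len_0 by (simp add: pathstart_def pathfinish_def)

end

section \<open>Logarithmic lower bound for the quasihyperbolic distance\<close>

lemma bdist_le: "bdist G z \<le> bdist G y + dist z y"
  unfolding bdist_def by (rule infdist_triangle)

lemma nn_integral_inverse_affine:
  fixes a c d :: real
  assumes "c \<le> d" "\<And>s. s \<in> {c..d} \<Longrightarrow> 0 < a + s"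
  shows "(\<integral>\<^sup>+s\<in>{c..d}. ennreal (1 / (a + s)) \<partial>lborel) = ennreal (ln (a + d) - ln (a + c))"
proof (rule nn_integral_FTC_Icc[where F = "\<lambda>s. ln (a + s)"])
  fix s assume "s \<in> {c..d}"
  with assms(2)[of s] show "DERIV (\<lambda>s. ln (a + s)) s :> 1 / (a + s)" "0 \<le> 1 / (a + s)"
    by (auto intro!: derivative_eq_intros)
qed (use assms in auto)

lemma nn_integral_inverse_affine_reflect:
  fixes a c d :: real
  assumes "c \<le> d" "\<And>s. s \<in> {c..d} \<Longrightarrow> 0 < a - s"
  shows "(\<integral>\<^sup>+s\<in>{c..d}. ennreal (1 / (a - s)) \<partial>lborel) = ennreal (ln (a - c) - ln (a - d))"
proof -
  have "(\<integral>\<^sup>+s\<in>{c..d}. ennreal (1 / (a - s)) \<partial>lborel) = ennreal (- ln (a - d) - (- ln (a - c)))"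
  proof (rule nn_integral_FTC_Icc[where F = "\<lambda>s. - ln (a - s)"])
    fix s assume "s \<in> {c..d}"
    with assms(2)[of s] show "DERIV (\<lambda>s. - ln (a - s)) s :> 1 / (a - s)" "0 \<le> 1 / (a - s)"
      by (auto intro!: derivative_eq_intros)
  qed (use assms in auto)
  then show ?thesis by simp
qed

text \<open>With \<open>D = dist x y\<close>, the boundary distance is at most
  \<open>bdist G x + s\<close> at arc length \<open>s\<close> from \<open>x\<close>, and likewise
  from \<open>y\<close>. Integrating over the initial and the final arc of length \<open>D/3\<close>
  gives one logarithm each. Having both in the sum is what makes the bound in
  \<open>qh_ball_bounds\<close> quadratic.\<close>

lemma qh_dist_ge:
  fixes x y :: "'a::euclidean_space"
  assumes pos: "\<And>z. z \<in> G \<Longrightarrow> 0 < bdist G z" and "x \<in> G" "y \<in> G"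
  shows "ennreal (ln (1 + dist x y / (3 * bdist G x)) + ln (1 + dist x y / (3 * bdist G y))) \<le> qh_dist G x y"
  unfolding qh_dist_def
proof (rule INF_greatest, clarify)
  fix \<gamma> assume \<gamma>: "rectifiable_curve \<gamma>" "path_image \<gamma> \<subseteq> G" "x = pathstart \<gamma>" "y = pathfinish \<gamma>"
  let ?x = "pathstart \<gamma>" let ?y = "pathfinish \<gamma>"
  define l where "l = enn2real (curve_length \<gamma> 0 1)"
  define D where "D = dist ?x ?y"
  define a where "a = bdist G ?x"
  define b where "b = bdist G ?y"
  have ab: "a > 0" "b > 0" using assms \<gamma> by (auto simp: a_def b_def)
  show "ennreal (ln (1 + dist ?x ?y / (3 * bdist G ?x)) + ln (1 + dist ?x ?y / (3 * bdist G ?y)))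
     \<le> arclength_integral \<gamma> (\<lambda>z. 1 / bdist G z)"
  proof (cases "D = 0")
    case True
    then show ?thesis by (simp add: D_def)
  next
    case False
    then have D: "D > 0" by (simp add: D_def)
    have "D \<le> l" using dist_le_len[OF \<gamma>(1)] by (simp add: D_def l_def)
    have p: "dist ?x (arclength_param \<gamma> s) \<le> s" "dist (arclength_param \<gamma> s) ?y \<le> l - s" "arclength_param \<gamma> s \<in> G"
       if "0 \<le> s" "s \<le> l" for s
      using dist_arclength_param[OF \<gamma>(1), of s] that \<gamma>(2) by (auto simp: l_def)
    have bnd: "bdist G (arclength_param \<gamma> s) \<le> a + s" "bdist G (arclength_param \<gamma> s) \<le> b + l - s"
       if "0 \<le> s" "s \<le> l" for s
      using p[OF that] bdist_le[of G "arclength_param \<gamma> s" ?x] bdist_le[of G "arclength_param \<gamma> s" ?y]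
      by (auto simp: a_def b_def dist_commute)
    have ln1: "ln (1 + D / (3 * a)) = ln (a + D/3) - ln a" if "a > 0" for a
      using that D ln_div[of "a + D/3" a] by (simp add: add_divide_distrib)
    have "ennreal (ln (1 + D / (3 * a)) + ln (1 + D / (3 * b))) =
        ennreal (ln (a + D/3) - ln (a + 0)) + ennreal (ln (b + l - (l - D/3)) - ln (b + l - l))"
      using ln1[OF ab(1)] ln1[OF ab(2)] ab D by (subst ennreal_plus[symmetric]) auto
    also have "\<dots> = (\<integral>\<^sup>+s\<in>{0..D/3}. ennreal (1 / (a + s)) \<partial>lborel) + (\<integral>\<^sup>+s\<in>{l-D/3..l}. ennreal (1 / (b + l - s)) \<partial>lborel)"
      using ab D by (subst nn_integral_inverse_affine nn_integral_inverse_affine_reflect; simp)+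
    also have "\<dots> = (\<integral>\<^sup>+s. (ennreal (1 / (a + s)) * indicator {0..D/3} s + ennreal (1 / (b + l - s)) * indicator {l-D/3..l} s) \<partial>lborel)"
      by (subst nn_integral_add) auto
    also have "\<dots> = (\<integral>\<^sup>+s. (ennreal (1 / (a + s)) * indicator {0..D/3} s + ennreal (1 / (b + l - s)) * indicator {l-D/3..l} s) \<partial>lebesgue)"
      by (rule nn_integral_completion[symmetric])
    also have "\<dots> \<le> (\<integral>\<^sup>+s\<in>{0..l}. ennreal (1 / bdist G (arclength_param \<gamma> s)) \<partial>lebesgue)"
    proof (rule nn_integral_mono)
      fix s
      show "ennreal (1 / (a + s)) * indicator {0..D/3} s + ennreal (1 / (b + l - s)) * indicator {l-D/3..l} s
        \<le> ennreal (1 / bdist G (arclength_param \<gamma> s)) * indicator {0..l} s"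
      proof (cases "0 \<le> s \<and> s \<le> l")
        case True
        then have "ennreal (1 / (a + s)) \<le> ennreal (1 / bdist G (arclength_param \<gamma> s))"
          "ennreal (1 / (b + l - s)) \<le> ennreal (1 / bdist G (arclength_param \<gamma> s))"
          using bnd[of s] pos[OF p(3)[of s]] by (auto intro!: ennreal_leI frac_le)
        \<comment> \<open>Arcs of length \<open>D/3\<close> keep the two closed intervals disjoint,
          so at each \<open>s\<close> at most one summand is nonzero.\<close>
        moreover have "\<not> (s \<le> D/3 \<and> l - D/3 \<le> s)" using \<open>D \<le> l\<close> D by auto
        ultimately show ?thesis using True by (auto simp: indicator_def)
      next
        case False
        then show ?thesis using \<open>D \<le> l\<close> D by (auto simp: indicator_def)
      qed
    qed
    finally show ?thesis by (simp add: arclength_integral_def D_def a_def b_def l_def)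
  qed
qed

subsection \<open>Regular measures\<close>

text \<open>Borel sets are Caratheodory measurable, so the outer measure restricts to a measure on
  them, against which one can integrate.\<close>

lemma regular_setE:
  fixes E :: "'a::euclidean_space set"
  assumes "regular_set Q \<alpha> \<beta> E" "bounded E"
  obtains N :: "'a measure" where "sets N = sets borel" "emeasure N (- E) = 0"
    "\<And>x r. x \<in> E \<Longrightarrow> 0 < r \<Longrightarrow> r < diameter E \<Longrightarrow> ennreal (\<alpha> * r powr Q) \<le> emeasure N (ball x r)"
    "\<And>x r. x \<in> E \<Longrightarrow> 0 < r \<Longrightarrow> r < diameter E \<Longrightarrow> emeasure N (ball x r) \<le> ennreal (\<beta> * r powr Q)"
proof -
  obtain \<mu> :: "'a set \<Rightarrow> ennreal" where \<mu>: "borel_regular_outer_measure \<mu>" "is_spt \<mu> E"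
    and reg: "\<And>x r. x \<in> E \<Longrightarrow> 0 < r \<Longrightarrow> r < diameter E \<Longrightarrow>
       ennreal (\<alpha> * r powr Q) \<le> \<mu> (ball x r) \<and> \<mu> (ball x r) \<le> ennreal (\<beta> * r powr Q)"
    using assms unfolding regular_set_def by auto
  have "measure_space UNIV (lambda_system UNIV UNIV \<mu>) \<mu>"
    using sigma_algebra.caratheodory_lemma[of UNIV UNIV \<mu>] \<mu>(1) sigma_algebra_Pow[of UNIV]
    by (simp add: borel_regular_outer_measure_def)
  moreover have "sigma_algebra (UNIV :: 'a set) (sets borel)"
    using sets.sigma_algebra_axioms[of "borel :: 'a measure"] by simp
  moreover have "sets borel \<subseteq> lambda_system UNIV UNIV \<mu>"
    using \<mu>(1) by (simp add: borel_regular_outer_measure_def)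
  ultimately have ms: "measure_space UNIV (sets borel) \<mu>"
    by (rule measure_down)
  have ems: "emeasure (measure_of UNIV (sets borel) \<mu>) A = \<mu> A" if "A \<in> sets borel" for A
    using ms that unfolding measure_space_def by (blast intro: emeasure_measure_of_sigma)
  have E: "- E \<in> sets borel" "\<mu> (- E) = 0"
    using \<mu>(2) borel_closed[of E] by (simp_all add: is_spt_def)
  show thesis
  proof (rule that)
    show "sets (measure_of UNIV (sets borel) \<mu>) = sets borel"
      using sets.sigma_sets_eq[of "borel :: 'a measure"] by (simp add: sets_measure_of_conv)
  qed (use reg E in \<open>auto simp: ems\<close>)
qed

text \<open>On the dyadic annulus \<open>S i\<close> the integrand is at most
  \<open>(2 ^ i * t) powr - a\<close> and the mass at most
  \<open>M * (2 ^ Suc i * t) powr b\<close>; the products form a geometric series of ratio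
  \<open>2 powr (b - a) < 1\<close>. It is applied to Lebesgue measure with
  \<open>b = DIM('a)\<close> and to the regular measure with \<open>b = Q\<close>.\<close>

lemma nn_integral_powr_shell:
  fixes x :: "'a::euclidean_space"
  assumes N: "sets N = sets borel" and a: "b < a" "0 \<le> a" and "0 < t" and M: "0 \<le> M"
    and bound: "\<And>R. t \<le> R \<Longrightarrow> emeasure N (ball x R) \<le> ennreal (M * R powr b)"
  shows "(\<integral>\<^sup>+ w \<in> {w. t \<le> dist w x}. ennreal (dist w x powr - a) \<partial>N)
     \<le> ennreal (M * 2 powr b / (1 - 2 powr (b - a)) * t powr (b - a))"
proof -
  have bm[measurable_cong]: "sets N = sets borel" by fact
  define q where "q = 2 powr (b - a)"
  have q: "0 < q" "q < 1" using a by (auto simp: q_def powr_less_one)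
  define S where "S i = ball x (2 ^ Suc i * t) - ball x (2 ^ i * t)" for i
  have S[measurable]: "S i \<in> sets N" for i by (simp add: S_def N)
  have "(\<integral>\<^sup>+ w \<in> {w. t \<le> dist w x}. ennreal (dist w x powr - a) \<partial>N)
     \<le> (\<integral>\<^sup>+ w. (\<Sum>i. ennreal ((2 ^ i * t) powr - a) * indicator (S i) w) \<partial>N)"
  proof (rule nn_integral_mono)
    fix w
    show "ennreal (dist w x powr - a) * indicator {w. t \<le> dist w x} w
       \<le> (\<Sum>i. ennreal ((2 ^ i * t) powr - a) * indicator (S i) w)"
    proof (cases "t \<le> dist w x")
      case tr: True
      define i where "i = (LEAST i. dist w x < 2 ^ Suc i * t)"
      obtain n where "dist w x / t < 2 ^ n" using real_arch_pow[of 2] by auto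
      then have "dist w x < 2 ^ n * t" using \<open>0 < t\<close>
        by (simp add: field_simps)
      also have "\<dots> \<le> 2 ^ Suc n * t" using \<open>0 < t\<close> by simp
      finally have "dist w x < 2 ^ Suc n * t" .
      then have i: "dist w x < 2 ^ Suc i * t" unfolding i_def by (rule LeastI)
      have i': "2 ^ i * t \<le> dist w x"
      proof (cases i)
        case 0 then show ?thesis using tr by simp
      next
        case (Suc j)
        then have "\<not> dist w x < 2 ^ Suc j * t" unfolding i_def using not_less_Least by (metis lessI)
        then show ?thesis by (simp add: Suc)
      qed
      have "ennreal (dist w x powr - a) \<le> ennreal ((2 ^ i * t) powr - a)"
        using i' \<open>0 < t\<close> a by (intro ennreal_leI powr_mono2') auto
      also have "\<dots> = (\<Sum>j\<in>{i}. ennreal ((2 ^ j * t) powr - a) * indicator (S j) w)"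
        using i i' by (simp add: S_def dist_commute)
      also have "\<dots> \<le> (\<Sum>j. ennreal ((2 ^ j * t) powr - a) * indicator (S j) w)"
        by (rule sum_le_suminf) auto
      finally show ?thesis using tr by simp
    qed simp
  qed
  also have "\<dots> = (\<Sum>i. ennreal ((2 ^ i * t) powr - a) * emeasure N (S i))"
    by (simp add: nn_integral_suminf nn_integral_cmult_indicator)
  also have "\<dots> \<le> (\<Sum>i. ennreal (M * 2 powr b * t powr (b - a) * q ^ i))"
  proof (intro suminf_le summableI)
    fix i :: nat
    have "emeasure N (S i) \<le> emeasure N (ball x (2 ^ Suc i * t))"
      by (rule emeasure_mono) (auto simp: S_def N)
    also have "\<dots> \<le> ennreal (M * (2 ^ Suc i * t) powr b)"
      using \<open>0 < t\<close> mult_right_mono[OF one_le_power[of 2 "Suc i"], of t] by (intro bound) simp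
    finally have "ennreal ((2 ^ i * t) powr - a) * emeasure N (S i)
       \<le> ennreal ((2 ^ i * t) powr - a) * ennreal (M * (2 ^ Suc i * t) powr b)"
      by (rule mult_left_mono) simp
    also have "\<dots> = ennreal ((2 ^ i * t) powr - a * (M * (2 ^ Suc i * t) powr b))"
      using M by (simp add: ennreal_mult)
    also have "(2 ^ i * t) powr - a * (M * (2 ^ Suc i * t) powr b)
        = M * 2 powr b * ((2 ^ i * t) powr - a * (2 ^ i * t) powr b)"
      using \<open>0 < t\<close> by (simp add: powr_mult mult.assoc)
    also have "(2 ^ i * t) powr - a * (2 ^ i * t) powr b = (2 ^ i * t) powr (b - a)"
      by (simp add: powr_add[symmetric])
    also have "\<dots> = q ^ i * t powr (b - a)"
      using \<open>0 < t\<close> by (simp add: powr_mult q_def powr_powr powr_realpow[symmetric] mult.commute)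
    finally show "ennreal ((2 ^ i * t) powr - a) * emeasure N (S i)
       \<le> ennreal (M * 2 powr b * t powr (b - a) * q ^ i)" by (simp add: mult_ac)
  qed
  also have "\<dots> = ennreal (M * 2 powr b * t powr (b - a) * (1 / (1 - q)))"
    using q M by (intro suminf_ennreal_eq sums_mult geometric_sums) auto
  finally show ?thesis by (simp add: q_def mult_ac)
qed

section \<open>Masses of balls and volumes of neighbourhoods\<close>

lemma ball_subset_ball_double: "dist z w < r \<Longrightarrow> ball z r \<subseteq> ball w (2 * r)"
  using dist_triangle_less_add[of w z r _ r] by (auto simp: dist_commute)

text \<open>The ball bounds are assumed only for centres in \<open>E\<close> and radii below the
  diameter; \<open>emeasure_ball_le_any\<close> extends the upper one to all centres and positive
  radii.\<close>

locale ahlfors_regular_measure =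
  fixes N :: "'a::euclidean_space measure" and E :: "'a set" and Q \<alpha> \<beta> \<delta> :: real
  assumes sets_N [measurable_cong]: "sets N = sets borel"
    and compact_E: "compact E" and diameter_E: "diameter E = \<delta>" and diam_pos: "0 < \<delta>"
    and null_compl: "emeasure N (- E) = 0"
    and Q_pos: "0 < Q" and Q_less: "Q < DIM('a)" and \<alpha>_pos: "0 < \<alpha>" and \<alpha>_le: "\<alpha> \<le> \<beta>"
    and emeasure_ball_ge: "x \<in> E \<Longrightarrow> 0 < r \<Longrightarrow> r < \<delta> \<Longrightarrow> ennreal (\<alpha> * r powr Q) \<le> emeasure N (ball x r)"
    and emeasure_ball_le: "x \<in> E \<Longrightarrow> 0 < r \<Longrightarrow> r < \<delta> \<Longrightarrow> emeasure N (ball x r) \<le> ennreal (\<beta> * r powr Q)"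
begin

lemma \<beta>_pos: "0 < \<beta>" using \<alpha>_pos \<alpha>_le by simp

lemma space_N [simp]: "space N = UNIV"
  using sets_eq_imp_space_eq[OF sets_N] by simp

lemma E_nonempty: "E \<noteq> {}"
  using diam_pos diameter_E by auto

lemma dist_le_\<delta>: "x \<in> E \<Longrightarrow> y \<in> E \<Longrightarrow> dist x y \<le> \<delta>"
  using diameter_bounded_bound[of E] compact_E diameter_E compact_imp_bounded by blast

lemma emeasure_N_disjoint:
  assumes "A \<inter> E = {}" shows "emeasure N A = 0"
proof -
  have "emeasure N A \<le> emeasure N (- E)"
    using assms borel_compact[OF compact_E] by (intro emeasure_mono) (auto simp: sets_N)
  then show ?thesis using null_compl by simp
qed

lemma emeasure_N_UNIV: "emeasure N UNIV = emeasure N E"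
proof -
  have "emeasure N UNIV = emeasure N E + emeasure N (- E)"
    using borel_compact[OF compact_E] by (subst plus_emeasure) (auto simp: sets_N)
  then show ?thesis using null_compl by simp
qed

text \<open>Finitely many balls of radius \<open>\<delta>/2\<close> cover \<open>E\<close>. Their
  number depends on \<open>E\<close>; a bound by the regularity data alone is
  \<open>mass_le\<close>.\<close>

lemma finite_measure_N: "finite_measure N"
proof
  have "E \<subseteq> (\<Union>x\<in>E. ball x (\<delta>/2))" using diam_pos by auto
  then obtain C where C: "C \<subseteq> E" "finite C" "E \<subseteq> (\<Union>x\<in>C. ball x (\<delta>/2))"
    using compactE_image[OF compact_E, of E "\<lambda>x. ball x (\<delta>/2)"] by blast
  have "emeasure N E \<le> emeasure N (\<Union>x\<in>C. ball x (\<delta>/2))"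
    using C by (intro emeasure_mono) (auto simp: sets_N)
  also have "\<dots> \<le> (\<Sum>x\<in>C. emeasure N (ball x (\<delta>/2)))"
    using C by (intro emeasure_subadditive_finite) (auto simp: sets_N)
  also have "\<dots> \<le> (\<Sum>x\<in>C. ennreal (\<beta> * (\<delta>/2) powr Q))"
    using C diam_pos by (intro sum_mono emeasure_ball_le) auto
  also have "\<dots> < \<infinity>" by (simp add: ennreal_mult_less_top of_nat_less_top)
  finally show "emeasure N (space N) \<noteq> \<infinity>" using emeasure_N_UNIV by simp
qed

sublocale finite_measure N by (rule finite_measure_N)

abbreviation mass :: real where "mass \<equiv> measure N UNIV"

lemma emeasure_mass: "emeasure N UNIV = ennreal mass"
  by (rule emeasure_eq_measure)

text \<open>Tonelli: \<open>dist z w < \<rho> z\<close> is read once as a condition on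
  \<open>w\<close> and once as a condition on \<open>z\<close>.\<close>

lemma nn_integral_emeasure_ball:
  assumes [measurable]: "f \<in> borel_measurable borel" "\<rho> \<in> borel_measurable borel"
  shows "(\<integral>\<^sup>+ z. f z * emeasure N (ball z (\<rho> z)) \<partial>lborel) =
    (\<integral>\<^sup>+ w. (\<integral>\<^sup>+ z. f z * indicator {z. dist z w < \<rho> z} z \<partial>lborel) \<partial>N)"
proof -
  interpret pair_sigma_finite N "lborel :: 'a measure" ..
  have "(\<integral>\<^sup>+ z. f z * emeasure N (ball z (\<rho> z)) \<partial>lborel) =
     (\<integral>\<^sup>+ z. (\<integral>\<^sup>+ w. f z * indicator {z. dist z w < \<rho> z} z \<partial>N) \<partial>lborel)"
  proof (rule nn_integral_cong)
    fix z
    have "(\<integral>\<^sup>+ w. f z * indicator {z. dist z w < \<rho> z} z \<partial>N) = (\<integral>\<^sup>+ w. f z * indicator (ball z (\<rho> z)) w \<partial>N)"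
      by (intro nn_integral_cong) (auto simp: indicator_def)
    also have "\<dots> = f z * emeasure N (ball z (\<rho> z))"
      by (rule nn_integral_cmult_indicator) (simp add: sets_N)
    finally show "f z * emeasure N (ball z (\<rho> z)) = (\<integral>\<^sup>+ w. f z * indicator {z. dist z w < \<rho> z} z \<partial>N)" ..
  qed
  also have "\<dots> = (\<integral>\<^sup>+ w. (\<integral>\<^sup>+ z. f z * indicator {z. dist z w < \<rho> z} z \<partial>lborel) \<partial>N)"
    by (rule Fubini') measurable
  finally show ?thesis .
qed

lemma nn_integral_emeasure_ball_const:
  assumes "0 \<le> R"
  shows "(\<integral>\<^sup>+ z. emeasure N (ball z R) \<partial>lborel) = ennreal (unit_ball_vol DIM('a) * R ^ DIM('a) * mass)"
proof -
  have "(\<integral>\<^sup>+ z. emeasure N (ball z R) \<partial>lborel) =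
     (\<integral>\<^sup>+ w. (\<integral>\<^sup>+ z. indicator {z. dist z w < R} z \<partial>lborel) \<partial>N)"
    using nn_integral_emeasure_ball[of "\<lambda>_. 1" "\<lambda>_. R"] by simp
  also have "\<dots> = (\<integral>\<^sup>+ w. ennreal (unit_ball_vol DIM('a) * R ^ DIM('a)) \<partial>N)"
  proof (rule nn_integral_cong)
    fix w :: 'a
    have "{z. dist z w < R} = ball w R" by (auto simp: dist_commute)
    then show "(\<integral>\<^sup>+ z. indicator {z. dist z w < R} z \<partial>lborel) = ennreal (unit_ball_vol DIM('a) * R ^ DIM('a))"
      using assms by (simp add: emeasure_ball)
  qed
  also have "\<dots> = ennreal (unit_ball_vol DIM('a) * R ^ DIM('a) * mass)"
    using assms by (simp add: emeasure_mass ennreal_mult)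
  finally show ?thesis .
qed

text \<open>The integral over \<open>z\<close> of the mass of \<open>ball z (\<delta>/4)\<close> is
  \<open>mass\<close> times the volume of such a ball. The integrand is at most
  \<open>\<beta> * \<delta> powr Q\<close> and vanishes outside \<open>ball w0 (2*\<delta>)\<close>;
  the ratio 8 of the radii gives the factor \<open>8 ^ DIM('a)\<close>.\<close>

lemma mass_le: "mass \<le> \<beta> * 8 ^ DIM('a) * \<delta> powr Q"
proof -
  obtain w0 where w0: "w0 \<in> E" using E_nonempty by blast
  have "ennreal (unit_ball_vol DIM('a) * (\<delta>/4) ^ DIM('a) * mass) = (\<integral>\<^sup>+ z. emeasure N (ball z (\<delta>/4)) \<partial>lborel)"
    using diam_pos by (subst nn_integral_emeasure_ball_const) auto
  also have "\<dots> \<le> (\<integral>\<^sup>+ z. ennreal (\<beta> * \<delta> powr Q) * indicator (ball w0 (2*\<delta>)) z \<partial>lborel)"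
  proof (rule nn_integral_mono)
    fix z
    show "emeasure N (ball z (\<delta>/4)) \<le> ennreal (\<beta> * \<delta> powr Q) * indicator (ball w0 (2*\<delta>)) z"
    proof (cases "ball z (\<delta>/4) \<inter> E = {}")
      case True
      then show ?thesis by (simp add: emeasure_N_disjoint)
    next
      case False
      then obtain w where w: "w \<in> E" "dist z w < \<delta>/4" by auto
      have "dist w0 z < 2 * \<delta>"
        using w dist_le_\<delta>[OF w0 w(1)] dist_triangle[of w0 z w] diam_pos by (simp add: dist_commute)
      have "emeasure N (ball z (\<delta>/4)) \<le> emeasure N (ball w (\<delta>/2))"
        using ball_subset_ball_double[OF w(2)] by (intro emeasure_mono) (auto simp: sets_N)
      also have "\<dots> \<le> ennreal (\<beta> * (\<delta>/2) powr Q)"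
        using w diam_pos by (intro emeasure_ball_le) auto
      also have "\<dots> \<le> ennreal (\<beta> * \<delta> powr Q)"
        using diam_pos Q_pos \<beta>_pos by (intro ennreal_leI mult_left_mono powr_mono2) auto
      finally show ?thesis using \<open>dist w0 z < 2 * \<delta>\<close> by simp
    qed
  qed
  also have "\<dots> = ennreal (\<beta> * \<delta> powr Q * (unit_ball_vol DIM('a) * (2*\<delta>) ^ DIM('a)))"
    using diam_pos \<beta>_pos by (simp add: nn_integral_cmult_indicator emeasure_ball ennreal_mult)
  finally have "unit_ball_vol DIM('a) * (\<delta>/4) ^ DIM('a) * mass \<le> \<beta> * \<delta> powr Q * (unit_ball_vol DIM('a) * (2*\<delta>) ^ DIM('a))"
    using diam_pos \<beta>_pos by (subst (asm) ennreal_le_iff) auto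
  also have "2 * \<delta> = 8 * (\<delta>/4)" by simp
  also have "\<beta> * \<delta> powr Q * (unit_ball_vol DIM('a) * (8 * (\<delta>/4)) ^ DIM('a)) = unit_ball_vol DIM('a) * (\<delta>/4) ^ DIM('a) * (\<beta> * 8 ^ DIM('a) * \<delta> powr Q)"
    by (simp only: power_mult_distrib mult_ac)
  finally show ?thesis
    by (rule mult_left_le_imp_le) (use diam_pos in auto)
qed

text \<open>A ball that meets \<open>E\<close> lies in a ball of twice the radius centred in
  \<open>E\<close>, whence \<open>2 powr Q\<close>. If the doubled radius reaches
  \<open>\<delta>\<close>, \<open>mass_le\<close> takes over, whence
  \<open>8 ^ DIM('a)\<close>.\<close>

lemma emeasure_ball_le_any:
  assumes "0 < r"
  shows "emeasure N (ball z r) \<le> ennreal (\<beta> * 8 ^ DIM('a) * 2 powr Q * r powr Q)"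
proof (cases "ball z r \<inter> E = {}")
  case True
  then show ?thesis by (simp add: emeasure_N_disjoint)
next
  case False
  then obtain w where w: "w \<in> E" "dist z w < r" by auto
  have "emeasure N (ball z r) \<le> emeasure N (ball w (2*r))"
    using ball_subset_ball_double[OF w(2)] by (intro emeasure_mono) (auto simp: sets_N)
  also have "\<dots> \<le> ennreal (\<beta> * 8 ^ DIM('a) * (2 * r) powr Q)"
  proof (cases "2 * r < \<delta>")
    case True
    have "\<beta> * 1 \<le> \<beta> * 8 ^ DIM('a)" using \<beta>_pos by (intro mult_left_mono) auto
    then show ?thesis
      using w assms True by (intro order_trans[OF emeasure_ball_le] ennreal_leI mult_right_mono) auto
  next
    case False
    have "emeasure N (ball w (2*r)) \<le> ennreal mass"
      by (subst emeasure_mass[symmetric]) (rule emeasure_mono, auto)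
    also have "\<dots> \<le> ennreal (\<beta> * 8 ^ DIM('a) * \<delta> powr Q)" by (rule ennreal_leI[OF mass_le])
    also have "\<dots> \<le> ennreal (\<beta> * 8 ^ DIM('a) * (2 * r) powr Q)"
      using False diam_pos Q_pos \<beta>_pos by (intro ennreal_leI mult_left_mono powr_mono2) auto
    finally show ?thesis .
  qed
  finally show ?thesis using assms by (simp add: powr_mult mult.assoc)
qed

lemma mass_ge: "\<alpha> * (\<delta>/2) powr Q \<le> mass"
proof -
  obtain w0 where w0: "w0 \<in> E" using E_nonempty by blast
  have "ennreal (\<alpha> * (\<delta>/2) powr Q) \<le> emeasure N (ball w0 (\<delta>/2))"
    using w0 diam_pos by (intro emeasure_ball_ge) auto
  also have "\<dots> \<le> ennreal mass"
    by (subst emeasure_mass[symmetric]) (rule emeasure_mono, auto)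
  finally show ?thesis by (subst (asm) ennreal_le_iff) auto
qed

abbreviation nbhd :: "real \<Rightarrow> 'a set" where "nbhd R \<equiv> {z. infdist z E < R}"

lemma borel_measurable_infdist [measurable]: "(\<lambda>z. infdist z E) \<in> borel_measurable borel"
  by (intro borel_measurable_continuous_onI continuous_intros)

lemma sets_nbhd [measurable]: "nbhd R \<in> sets borel"
  by measurable

lemma infdist_attainsE:
  obtains w where "w \<in> E" "infdist z E = dist z w"
  using infdist_attains_inf[OF compact_imp_closed[OF compact_E] E_nonempty] by blast

lemma emeasure_ball_infdist_ge:
  assumes "infdist z E < R" "R < \<delta>"
  shows "ennreal (\<alpha> * R powr Q) \<le> emeasure N (ball z (2 * R))"
proof -
  obtain w where w: "w \<in> E" "infdist z E = dist z w" by (rule infdist_attainsE)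
  have "R > 0" using assms infdist_nonneg[of z E] by linarith
  then have "ennreal (\<alpha> * R powr Q) \<le> emeasure N (ball w R)"
    using w assms by (intro emeasure_ball_ge) auto
  also have "\<dots> \<le> emeasure N (ball z (2 * R))"
  proof (rule emeasure_mono)
    show "ball w R \<subseteq> ball z (2 * R)"
    proof
      fix y assume "y \<in> ball w R"
      then show "y \<in> ball z (2 * R)" using w assms dist_triangle[of z y w] by simp
    qed
  qed (simp add: sets_N)
  finally show ?thesis .
qed

text \<open>Every point of \<open>nbhd R\<close> sees mass at least
  \<open>\<alpha> * R powr Q\<close> within distance \<open>2 * R\<close>, while the integral of
  this mass over all points is \<open>mass\<close> times the volume of a ball of radius
  \<open>2 * R\<close>.\<close>

lemma emeasure_nbhd_le:
  assumes "0 < R" "R < \<delta>"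
  shows "emeasure lborel (nbhd R) \<le> ennreal (unit_ball_vol DIM('a) * 2 ^ DIM('a) / \<alpha> * mass * R powr (DIM('a) - Q))"
proof -
  have "ennreal (\<alpha> * R powr Q) * emeasure lborel (nbhd R) = (\<integral>\<^sup>+ z. ennreal (\<alpha> * R powr Q) * indicator (nbhd R) z \<partial>lborel)"
    by (subst nn_integral_cmult_indicator) auto
  also have "\<dots> \<le> (\<integral>\<^sup>+ z. emeasure N (ball z (2 * R)) \<partial>lborel)"
    using assms emeasure_ball_infdist_ge by (intro nn_integral_mono) (auto simp: indicator_def)
  also have "\<dots> = ennreal (unit_ball_vol DIM('a) * (2 * R) ^ DIM('a) * mass)"
    using assms by (subst nn_integral_emeasure_ball_const) auto
  also have "unit_ball_vol DIM('a) * (2 * R) ^ DIM('a) * mass = (\<alpha> * R powr Q) * (unit_ball_vol DIM('a) * 2 ^ DIM('a) / \<alpha> * mass * R powr (DIM('a) - Q))"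
    using assms \<alpha>_pos by (simp add: powr_diff powr_realpow power_mult_distrib)
  also have "ennreal \<dots> = ennreal (\<alpha> * R powr Q) * ennreal (unit_ball_vol DIM('a) * 2 ^ DIM('a) / \<alpha> * mass * R powr (DIM('a) - Q))"
    using \<alpha>_pos by (intro ennreal_mult) auto
  finally show ?thesis
    using \<alpha>_pos assms by (subst (asm) ennreal_mult_le_mult_iff) auto
qed

text \<open>Conversely, the mass of \<open>ball z R\<close> vanishes unless \<open>z\<close> is in
  \<open>nbhd R\<close>, and is at most a multiple of \<open>R powr Q\<close> there.\<close>

lemma emeasure_nbhd_ge:
  assumes "0 < R"
  shows "ennreal (unit_ball_vol DIM('a) / (\<beta> * 8 ^ DIM('a) * 2 powr Q) * mass * R powr (DIM('a) - Q)) \<le> emeasure lborel (nbhd R)"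
proof -
  define B where "B = \<beta> * 8 ^ DIM('a) * 2 powr Q"
  have B: "B > 0" using \<beta>_pos by (simp add: B_def)
  have "ennreal (B * R powr Q) * ennreal (unit_ball_vol DIM('a) / B * mass * R powr (DIM('a) - Q))
      = ennreal ((B * R powr Q) * (unit_ball_vol DIM('a) / B * mass * R powr (DIM('a) - Q)))"
    using B by (intro ennreal_mult[symmetric]) auto
  also have "(B * R powr Q) * (unit_ball_vol DIM('a) / B * mass * R powr (DIM('a) - Q)) = unit_ball_vol DIM('a) * R ^ DIM('a) * mass"
    using assms B by (simp add: powr_diff powr_realpow)
  also have "ennreal (unit_ball_vol DIM('a) * R ^ DIM('a) * mass) = (\<integral>\<^sup>+ z. emeasure N (ball z R) \<partial>lborel)"
    using assms by (subst nn_integral_emeasure_ball_const) auto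
  also have "\<dots> \<le> (\<integral>\<^sup>+ z. ennreal (B * R powr Q) * indicator (nbhd R) z \<partial>lborel)"
  proof (rule nn_integral_mono)
    fix z
    show "emeasure N (ball z R) \<le> ennreal (B * R powr Q) * indicator (nbhd R) z"
    proof (cases "ball z R \<inter> E = {}")
      case True
      then show ?thesis by (simp add: emeasure_N_disjoint)
    next
      case False
      then obtain w where "w \<in> E" "dist z w < R" by auto
      then have "infdist z E < R" using infdist_le[of w E z] by simp
      then show ?thesis using emeasure_ball_le_any[OF assms, of z] by (simp add: B_def)
    qed
  qed
  also have "\<dots> = ennreal (B * R powr Q) * emeasure lborel (nbhd R)"
    by (subst nn_integral_cmult_indicator) auto
  finally show ?thesis
    using B assms by (subst (asm) ennreal_mult_le_mult_iff) (auto simp: B_def)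
qed

text \<open>The volume of \<open>nbhd R\<close> tends to 0 with \<open>R\<close> because
  \<open>Q < DIM('a)\<close>, and a null open set is empty. It follows that the frontier of
  \<open>- E\<close> is all of \<open>E\<close>.\<close>

lemma interior_E: "interior E = {}"
proof (rule ccontr)
  assume ne: "interior E \<noteq> {}"
  define c where "c = unit_ball_vol DIM('a) * 2 ^ DIM('a) / \<alpha> * mass"
  have "emeasure lborel (interior E) \<le> ennreal (c * R powr (DIM('a) - Q))" if "0 < R" "R < \<delta>" for R
  proof -
    have "interior E \<subseteq> nbhd R" using that interior_subset[of E] by auto
    then have "emeasure lborel (interior E) \<le> emeasure lborel (nbhd R)" by (intro emeasure_mono) auto
    then show ?thesis using emeasure_nbhd_le[OF that] unfolding c_def by (rule order_trans)
  qed
  then have "\<forall>\<^sub>F R in at_right 0. emeasure lborel (interior E) \<le> ennreal (c * R powr (DIM('a) - Q))"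
    using diam_pos by (auto simp: eventually_at_right)
  moreover have "((\<lambda>R. ennreal (c * R powr (DIM('a) - Q))) \<longlongrightarrow> ennreal (c * 0 powr (DIM('a) - Q))) (at_right 0)"
    using Q_less by (intro tendsto_ennrealI tendsto_intros) (auto intro: eventually_mono[OF eventually_at_right_less])
  ultimately have "emeasure lborel (interior E) \<le> ennreal (c * 0 powr (DIM('a) - Q))"
    by (intro tendsto_lowerbound) auto
  then have "emeasure lborel (interior E) = 0" by simp
  then have "negligible (interior E)"
    by (simp add: negligible_iff_emeasure0 emeasure_completion)
  then show False using open_not_negligible[of "interior E"] ne by simp
qed

lemma bdist_compl: "bdist (- E) z = infdist z E"
  using interior_E compact_imp_closed[OF compact_E] frontier_def[of E]
  by (simp add: bdist_def frontier_complement)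

end

subsection \<open>Quasihyperbolic volume\<close>

text \<open>Chosen so that the lower volume bound for the neighbourhood of radius \<open>K * s\<close> is twice the upper
  bound for the one of radius \<open>s\<close>.\<close>

definition shell_ratio :: "nat \<Rightarrow> real \<Rightarrow> real \<Rightarrow> real \<Rightarrow> real" where
  "shell_ratio n Q \<alpha> \<beta> = (2 * \<beta> * 16 ^ n * 2 powr Q / \<alpha>) powr (1 / (real n - Q))"

text \<open>The bound of \<open>qh_volume_shell_ge\<close> at
  \<open>s = 2 * (t + 2 * \<delta>) * exp (- r / L)\<close>, with the factor
  \<open>exp (Q * r / L)\<close> split off.\<close>

definition lower_const :: "nat \<Rightarrow> real \<Rightarrow> real \<Rightarrow> real \<Rightarrow> real \<Rightarrow> real \<Rightarrow> real" where
  "lower_const n Q \<alpha> \<beta> \<delta> t =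
     unit_ball_vol n * 2 ^ n * (\<delta>/2) powr Q / shell_ratio n Q \<alpha> \<beta> ^ n * (2 * (t + 2 * \<delta>)) powr - Q"

text \<open>The first summand belongs to the points within \<open>\<delta>\<close> of
  \<open>E\<close> and contains two tail constants, one for Lebesgue measure and one for the regular
  measure. The second belongs to the remaining points.\<close>

definition upper_const :: "nat \<Rightarrow> real \<Rightarrow> real \<Rightarrow> real \<Rightarrow> real \<Rightarrow> real" where
  "upper_const n Q \<alpha> \<beta> \<delta> =
     2 powr (n + Q) / \<alpha> * (unit_ball_vol n * 2 powr n / (1 - 2 powr - Q))
       * (\<beta> * 8 ^ n * 2 powr Q * 2 powr Q / (1 - 2 powr - Q)) * 36 powr Q
     + 2 powr (n + Q/2) * (unit_ball_vol n * 2 powr n / (1 - 2 powr - (Q/2))) * \<delta> powr - (Q/2)"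

lemma nn_integral_indicator_lebesgue:
  fixes f :: "'a::euclidean_space \<Rightarrow> ennreal"
  assumes "A \<in> sets borel" "f \<in> borel_measurable borel"
  shows "(\<integral>\<^sup>+ z \<in> A. f z \<partial>lebesgue) = (\<integral>\<^sup>+ z \<in> A. f z \<partial>lborel)"
  using assms by (intro nn_integral_completion)

lemma powr_minus_half:
  fixes x c :: real
  assumes "0 \<le> x" shows "(x / 2) powr - c = 2 powr c * x powr - c"
  using assms by (simp add: powr_divide powr_minus_divide)

context ahlfors_regular_measure
begin

section \<open>Lower bound for the volume\<close>

context
  fixes K :: real
  assumes K_eq: "K = shell_ratio DIM('a) Q \<alpha> \<beta>"
begin

lemma shell_ratio_ge_1: "1 \<le> K"
proof -
  have "1 \<le> 16 ^ DIM('a) * (2::real) powr Q"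
    using Q_pos mult_mono[of 1 "16 ^ DIM('a)" 1 "(2::real) powr Q"] by (simp add: ge_one_powr_ge_zero)
  then have "\<alpha> * 1 \<le> 2 * \<beta> * (16 ^ DIM('a) * 2 powr Q)"
    using \<alpha>_pos \<alpha>_le by (intro mult_mono) auto
  then have "1 \<le> 2 * \<beta> * 16 ^ DIM('a) * 2 powr Q / \<alpha>" using \<alpha>_pos by simp
  then show ?thesis unfolding K_eq shell_ratio_def using Q_less by (intro ge_one_powr_ge_zero) auto
qed

lemma shell_ratio_powr: "K powr (DIM('a) - Q) = 2 * \<beta> * 16 ^ DIM('a) * 2 powr Q / \<alpha>"
  using Q_less \<alpha>_pos \<beta>_pos by (simp add: K_eq shell_ratio_def powr_powr)

abbreviation shell :: "real \<Rightarrow> 'a set" where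
  "shell s \<equiv> {z. s \<le> infdist z E \<and> infdist z E < K * s}"

lemma sets_shell [measurable]: "shell s \<in> sets borel"
  by measurable

text \<open>The upper bound for the volume of \<open>nbhd s\<close> is \<open>X\<close>, and by
  \<open>shell_ratio_powr\<close> the lower bound for \<open>nbhd (K * s)\<close> is
  \<open>X + X\<close>. Removing \<open>nbhd s\<close> leaves at least \<open>X\<close>.\<close>

lemma emeasure_shell_ge:
  assumes "0 < s" "K * s < \<delta>"
  shows "ennreal (unit_ball_vol DIM('a) * 2 ^ DIM('a) / \<alpha> * mass * s powr (DIM('a) - Q)) \<le> emeasure lborel (shell s)"
proof -
  define X where "X = unit_ball_vol DIM('a) * 2 ^ DIM('a) / \<alpha> * mass * s powr (DIM('a) - Q)"
  have X: "X \<ge> 0" using \<alpha>_pos by (simp add: X_def)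
  have Ks: "s \<le> K * s" using shell_ratio_ge_1 assms(1) by simp
  have "X + X = unit_ball_vol DIM('a) / (\<beta> * 8 ^ DIM('a) * 2 powr Q) * mass * (K * s) powr (DIM('a) - Q)"
  proof -
    have "(16::real) ^ DIM('a) = 8 ^ DIM('a) * 2 ^ DIM('a)" by (simp flip: power_mult_distrib)
    moreover have "(K * s) powr (DIM('a) - Q) = 2 * \<beta> * 16 ^ DIM('a) * 2 powr Q / \<alpha> * s powr (DIM('a) - Q)"
      using assms shell_ratio_ge_1 by (subst powr_mult) (auto simp: shell_ratio_powr)
    ultimately show ?thesis
      unfolding X_def using \<beta>_pos by simp
  qed
  then have "ennreal X + ennreal X \<le> emeasure lborel (nbhd (K * s))"
    using emeasure_nbhd_ge[of "K * s"] assms Ks X by (simp flip: ennreal_plus)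
  also have "\<dots> \<le> emeasure lborel (shell s \<union> nbhd s)"
    by (rule emeasure_mono) auto
  also have "\<dots> \<le> emeasure lborel (shell s) + emeasure lborel (nbhd s)"
    by (rule emeasure_subadditive) auto
  also have "\<dots> \<le> emeasure lborel (shell s) + ennreal X"
    using emeasure_nbhd_le[of s] assms Ks by (intro add_left_mono) (simp add: X_def)
  finally show ?thesis
    unfolding X_def[symmetric] by (simp add: add.commute ennreal_add_left_cancel_le)
qed

text \<open>For \<open>z\<close> in the shell, \<open>x\<close> and \<open>z\<close> both have
  distance at least \<open>s\<close> from \<open>E\<close>, and passing through nearest points of
  \<open>E\<close> gives \<open>dist x z \<le> infdist x E + 2 * \<delta>\<close>. Uniformity turns
  this into a quasihyperbolic distance below \<open>r\<close>.\<close>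

lemma qh_ball_superset_shell:
  assumes unif: "uniform_domain L (- E)" and x: "x \<notin> E"
    and s: "0 < s" "s \<le> infdist x E" "K * s < \<delta>" "1 + (infdist x E + 2 * \<delta>) / s < exp (r / L)"
  shows "shell s \<subseteq> qh_ball (- E) x r"
proof
  fix z assume z: "z \<in> shell s"
  have L: "1 < L" using unif by (simp add: uniform_domain_def)
  obtain w where w: "w \<in> E" "infdist z E = dist z w" by (rule infdist_attainsE)
  obtain w' where w': "w' \<in> E" "infdist x E = dist x w'" by (rule infdist_attainsE)
  have "dist x z \<le> dist x w' + dist w' w + dist w z"
    using dist_triangle[of x z w'] dist_triangle[of w' z w] by linarith
  also have "\<dots> \<le> infdist x E + 2 * \<delta>"
    using dist_le_\<delta>[OF w'(1) w(1)] w w' z s(3) by (simp add: dist_commute)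
  finally have D: "dist x z \<le> infdist x E + 2 * \<delta>" .
  have "z \<in> - E" using z s(1) by auto
  then have qd: "qh_dist (- E) x z \<le> ennreal (L * ln (1 + dist x z / min (infdist x E) (infdist z E)))"
    using unif x by (simp add: uniform_domain_def bdist_compl)
  have "dist x z / min (infdist x E) (infdist z E) \<le> (infdist x E + 2 * \<delta>) / s"
    using z s D by (intro frac_le) (auto intro: order_trans[OF zero_le_dist])
  then have "1 + dist x z / min (infdist x E) (infdist z E) < exp (r / L)"
    using s(4) by linarith
  then have "ln (1 + dist x z / min (infdist x E) (infdist z E)) < r / L"
    using ln_less_cancel_iff[of "1 + dist x z / min (infdist x E) (infdist z E)" "exp (r / L)"]
    by (simp add: add_pos_nonneg infdist_nonneg)
  then have "L * ln (1 + dist x z / min (infdist x E) (infdist z E)) < r"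
    using L by (simp add: field_simps)
  moreover have "0 \<le> L * ln (1 + dist x z / min (infdist x E) (infdist z E))"
    using L by (intro mult_nonneg_nonneg ln_ge_zero) (auto simp: infdist_nonneg)
  ultimately have "ennreal (L * ln (1 + dist x z / min (infdist x E) (infdist z E))) < ennreal r"
    by (intro ennreal_lessI) auto
  with qd have "qh_dist (- E) x z < ennreal r" by (rule order_le_less_trans)
  then show "z \<in> qh_ball (- E) x r" using \<open>z \<in> - E\<close> by (simp add: qh_ball_def)
qed

text \<open>The density is at least \<open>1 / (K * s) ^ DIM('a)\<close> on the shell, whose volume
  is of order \<open>s powr (DIM('a) - Q)\<close>. The \<open>\<alpha>\<close> in
  \<open>mass_ge\<close> cancels the one in the denominator of the volume bound.\<close>

lemma qh_volume_shell_ge: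
  assumes "0 < s" "K * s < \<delta>" "shell s \<subseteq> A"
  shows "ennreal (unit_ball_vol DIM('a) * 2 ^ DIM('a) * (\<delta>/2) powr Q / K ^ DIM('a) * s powr - Q) \<le> qh_volume (- E) A"
proof -
  have K: "0 < K" using shell_ratio_ge_1 by linarith
  have "unit_ball_vol DIM('a) * 2 ^ DIM('a) * (\<delta>/2) powr Q / K ^ DIM('a) * s powr - Q
     = 1 / (K * s) ^ DIM('a) * (unit_ball_vol DIM('a) * 2 ^ DIM('a) / \<alpha> * (\<alpha> * (\<delta>/2) powr Q) * s powr (DIM('a) - Q))"
    using assms(1) \<alpha>_pos K by (simp add: powr_diff powr_realpow powr_minus_divide power_mult_distrib)
  also have "\<dots> \<le> 1 / (K * s) ^ DIM('a) * (unit_ball_vol DIM('a) * 2 ^ DIM('a) / \<alpha> * mass * s powr (DIM('a) - Q))"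
    using assms(1) \<alpha>_pos K mass_ge by (intro mult_left_mono mult_right_mono) auto
  finally have "ennreal (unit_ball_vol DIM('a) * 2 ^ DIM('a) * (\<delta>/2) powr Q / K ^ DIM('a) * s powr - Q)
     \<le> ennreal (1 / (K * s) ^ DIM('a) * (unit_ball_vol DIM('a) * 2 ^ DIM('a) / \<alpha> * mass * s powr (DIM('a) - Q)))"
    by (rule ennreal_leI)
  also have "\<dots> = ennreal (1 / (K * s) ^ DIM('a)) * ennreal (unit_ball_vol DIM('a) * 2 ^ DIM('a) / \<alpha> * mass * s powr (DIM('a) - Q))"
    using assms(1) \<alpha>_pos K by (intro ennreal_mult) auto
  also have "\<dots> \<le> ennreal (1 / (K * s) ^ DIM('a)) * emeasure lborel (shell s)"
    by (intro mult_left_mono emeasure_shell_ge assms) auto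
  also have "\<dots> = (\<integral>\<^sup>+ z \<in> shell s. ennreal (1 / (K * s) ^ DIM('a)) \<partial>lborel)"
    by (subst nn_integral_cmult_indicator) auto
  also have "\<dots> = (\<integral>\<^sup>+ z \<in> shell s. ennreal (1 / (K * s) ^ DIM('a)) \<partial>lebesgue)"
    by (rule nn_integral_indicator_lebesgue[symmetric]) auto
  also have "\<dots> \<le> qh_volume (- E) A"
    unfolding qh_volume_def bdist_compl
  proof (rule nn_integral_mono)
    fix z
    have "1 / (K * s) ^ DIM('a) \<le> 1 / infdist z E ^ DIM('a)" if "z \<in> shell s"
      using that assms(1) by (intro divide_left_mono power_mono) (auto simp: infdist_nonneg intro!: mult_pos_pos zero_less_power K)
    then show "ennreal (1 / (K * s) ^ DIM('a)) * indicator (shell s) z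
       \<le> ennreal (1 / infdist z E ^ DIM('a)) * indicator A z"
      using assms(3) by (auto simp: indicator_def intro: ennreal_leI)
  qed
  finally show ?thesis .
qed

lemma qh_volume_ge:
  assumes unif: "uniform_domain L (- E)" and x: "x \<notin> E" and t: "t = infdist x E"
    and r: "2 < exp (r / L)" "2 * (t + 2 * \<delta>) * exp (- r / L) \<le> t" "K * (2 * (t + 2 * \<delta>) * exp (- r / L)) < \<delta>"
  shows "ennreal (lower_const DIM('a) Q \<alpha> \<beta> \<delta> t * exp (Q * r / L)) \<le> qh_volume (- E) (qh_ball (- E) x r)"
proof -
  have tn: "0 \<le> t" by (simp add: t infdist_nonneg)
  \<comment> \<open>The factor 2 makes \<open>(t + 2 * \<delta>) / s\<close> half of
    \<open>exp (r / L)\<close>; the other half exceeds 1 by the first assumption on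
    \<open>r\<close>.\<close>
  define s where "s = 2 * (t + 2 * \<delta>) * exp (- r / L)"
  have s: "0 < s" "s \<le> t" "K * s < \<delta>" using r tn diam_pos by (auto simp: s_def)
  have "(t + 2 * \<delta>) / s = exp (r / L) / 2"
    using tn diam_pos by (simp add: s_def exp_minus field_simps flip: exp_add)
  then have "1 + (t + 2 * \<delta>) / s < exp (r / L)" using r(1) by linarith
  then have "shell s \<subseteq> qh_ball (- E) x r"
    using s by (intro qh_ball_superset_shell[OF unif x]) (auto simp: t)
  moreover have "s powr - Q = (2 * (t + 2 * \<delta>)) powr - Q * exp (Q * r / L)"
    using tn diam_pos by (simp add: s_def powr_mult exp_powr_real mult.commute)
  ultimately show ?thesis
    using qh_volume_shell_ge[OF s(1,3)] by (simp add: lower_const_def K_eq[symmetric] mult.assoc)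
qed

end

section \<open>Upper bound for the volume\<close>

lemma qh_ball_bounds:
  assumes x: "x \<notin> E" and t: "t = infdist x E" and z: "z \<in> qh_ball (- E) x r"
  shows "0 < infdist z E" and "(dist x z)\<^sup>2 \<le> 9 * t * exp r * infdist z E"
    and "infdist z E \<le> t + 3 * t * exp r"
proof -
  have cl: "closed E" by (rule compact_imp_closed[OF compact_E])
  have pos: "0 < bdist (- E) y" if "y \<in> - E" for y
    using that in_closed_iff_infdist_zero[OF cl E_nonempty, of y] infdist_nonneg[of y E] by (simp add: bdist_compl less_le)
  have zE: "z \<in> - E" and zr: "qh_dist (- E) x z < ennreal r" using z by (auto simp: qh_ball_def)
  define d where "d = infdist z E"
  define D where "D = dist x z"
  show d: "0 < infdist z E" using pos[OF zE] by (simp add: bdist_compl)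
  have t0: "0 < t" using pos[of x] x by (simp add: t bdist_compl)
  have "ennreal (ln (1 + D / (3 * t)) + ln (1 + D / (3 * d))) \<le> qh_dist (- E) x z"
    using qh_dist_ge[of "- E" x z] pos x zE by (simp add: bdist_compl t D_def d_def)
  with zr have "ennreal (ln (1 + D / (3 * t)) + ln (1 + D / (3 * d))) < ennreal r" by simp
  then have lt: "ln (1 + D / (3 * t)) + ln (1 + D / (3 * d)) < r"
    using ennreal_leI leD not_le by blast
  have dd: "0 < d" "0 \<le> D" using d by (auto simp: d_def D_def)
  have "exp (ln (1 + D / (3 * t)) + ln (1 + D / (3 * d))) < exp r" using lt by simp
  then have pr: "(1 + D / (3 * t)) * (1 + D / (3 * d)) < exp r"
    using dd t0 by (simp add: exp_add add_pos_nonneg)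
  \<comment> \<open>Dropping the 1 in both factors gives the quadratic bound. Keeping the 1 of the
    second factor gives, further below, \<open>D \<le> 3 * t * exp r\<close> and thereby the bound
    on \<open>infdist z E\<close>.\<close>
  have "D / (3 * t) * (D / (3 * d)) \<le> (1 + D / (3 * t)) * (1 + D / (3 * d))"
    using dd t0 by (intro mult_mono) auto
  with pr have "D / (3 * t) * (D / (3 * d)) \<le> exp r" by linarith
  then show "(dist x z)\<^sup>2 \<le> 9 * t * exp r * infdist z E"
    using dd t0 by (simp add: D_def[symmetric] d_def[symmetric] field_simps power2_eq_square)
  have "D / (3 * t) * 1 \<le> (1 + D / (3 * t)) * (1 + D / (3 * d))"
    using dd t0 by (intro mult_mono) auto
  with pr have "D \<le> 3 * t * exp r" using t0 by (simp add: field_simps)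
  moreover have "infdist z E \<le> t + D"
    using infdist_triangle[of z E x] by (simp add: t D_def dist_commute)
  ultimately show "infdist z E \<le> t + 3 * t * exp r" by simp
qed

lemma nn_integral_powr_shell_lborel:
  fixes a t :: real
  assumes "0 < t" "DIM('a) < a"
  shows "(\<integral>\<^sup>+ z \<in> {z. t \<le> dist z w}. ennreal (dist z w powr - a) \<partial>(lborel :: 'a measure))
    \<le> ennreal (unit_ball_vol DIM('a) * 2 powr DIM('a) / (1 - 2 powr (DIM('a) - a)) * t powr (DIM('a) - a))"
  using assms by (intro nn_integral_powr_shell) (auto simp: emeasure_ball powr_realpow)

text \<open>Here \<open>w \<in> E\<close> with \<open>dist z w < 2 * infdist z E\<close> is far from \<open>z \<in> A\<close>: if \<open>w\<close> is not already at distance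
  \<open>dist w x / 2\<close> from \<open>z\<close>, then \<open>dist x z \<ge> dist w x / 2\<close> and \<open>D\<close> bounds \<open>infdist z E\<close> from below.
  The threshold is quadratic in \<open>dist w x\<close>, so the remaining integral over \<open>E\<close> converges at scale \<open>t\<close>
  and the powers of \<open>t\<close> cancel: this is why the upper constant is independent of \<open>d(x)\<close>.\<close>

lemma qh_volume_near_le:
  assumes t: "0 < t" "t = infdist x E" and r: "t + \<delta> \<le> 18 * t * exp r"
    and A [measurable]: "A \<in> sets borel"
    and d: "\<And>z. z \<in> A \<Longrightarrow> 0 < infdist z E" "\<And>z. z \<in> A \<Longrightarrow> infdist z E < \<delta>"
    and D: "\<And>z. z \<in> A \<Longrightarrow> (dist x z)\<^sup>2 \<le> 9 * t * exp r * infdist z E"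
  shows "(\<integral>\<^sup>+ z \<in> A. ennreal (1 / infdist z E ^ DIM('a)) \<partial>lborel) \<le>
     ennreal (2 powr (DIM('a) + Q) / \<alpha> * (unit_ball_vol DIM('a) * 2 powr DIM('a) / (1 - 2 powr - Q))
       * (\<beta> * 8 ^ DIM('a) * 2 powr Q * 2 powr Q / (1 - 2 powr - Q)) * 36 powr Q * exp (Q * r))"
proof -
  define c1 where "c1 = unit_ball_vol DIM('a) * 2 powr DIM('a) / (1 - 2 powr - Q)"
  define c2 where "c2 = \<beta> * 8 ^ DIM('a) * 2 powr Q * 2 powr Q / (1 - 2 powr - Q)"
  define B where "B = 2 powr (DIM('a) + Q) / \<alpha>"
  have "(2::real) powr - Q < 1" using Q_pos by (simp add: powr_less_one)
  then have c: "0 \<le> c1" "0 \<le> c2" "0 \<le> B" using \<beta>_pos \<alpha>_pos by (auto simp: c1_def c2_def B_def)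
  define f where "f z = ennreal (infdist z E powr - (DIM('a) + Q) / \<alpha>) * indicator A z" for z
  have [measurable]: "f \<in> borel_measurable borel" unfolding f_def by measurable
  have "(\<integral>\<^sup>+ z \<in> A. ennreal (1 / infdist z E ^ DIM('a)) \<partial>lborel)
     \<le> (\<integral>\<^sup>+ z. f z * emeasure N (ball z (2 * infdist z E)) \<partial>lborel)"
  proof (rule nn_integral_mono)
    fix z
    show "ennreal (1 / infdist z E ^ DIM('a)) * indicator A z \<le> f z * emeasure N (ball z (2 * infdist z E))"
    proof (cases "z \<in> A")
      case True
      obtain w where w: "w \<in> E" "infdist z E = dist z w" by (rule infdist_attainsE)
      let ?d = "infdist z E"
      have "ennreal (1 / ?d ^ DIM('a)) = ennreal (?d powr - (DIM('a) + Q) / \<alpha> * (\<alpha> * ?d powr Q))"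
        using d[OF True] \<alpha>_pos by (simp add: powr_minus_divide powr_realpow flip: powr_add)
      also have "\<dots> = ennreal (?d powr - (DIM('a) + Q) / \<alpha>) * ennreal (\<alpha> * ?d powr Q)"
        using \<alpha>_pos by (intro ennreal_mult) auto
      also have "ennreal (\<alpha> * ?d powr Q) \<le> emeasure N (ball w ?d)"
        using w d[OF True] by (intro emeasure_ball_ge) auto
      also have "\<dots> \<le> emeasure N (ball z (2 * ?d))"
      proof (rule emeasure_mono)
        show "ball w ?d \<subseteq> ball z (2 * ?d)"
        proof
          fix y assume "y \<in> ball w ?d"
          then show "y \<in> ball z (2 * ?d)" using w dist_triangle[of z y w] by simp
        qed
      qed (simp add: sets_N)
      finally show ?thesis using True by (simp add: f_def mult_left_mono)
    qed simp
  qed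
  also have "\<dots> = (\<integral>\<^sup>+ w. (\<integral>\<^sup>+ z. f z * indicator {z. dist z w < 2 * infdist z E} z \<partial>lborel) \<partial>N)"
    by (rule nn_integral_emeasure_ball) measurable
  \<comment> \<open>The inner integral is estimated only for \<open>w\<close> in \<open>E\<close>,
    which suffices almost everywhere. There \<open>t \<le> dist w x\<close> always holds; the
    restriction puts the outer integral into the form of
    \<open>nn_integral_powr_shell\<close>.\<close>
  also have "\<dots> \<le> (\<integral>\<^sup>+ w \<in> {w. t \<le> dist w x}. ennreal (B * c1 * (36 * t * exp r) powr Q) * ennreal (dist w x powr - (2 * Q)) \<partial>N)"
  proof (rule nn_integral_mono_AE, rule AE_I')
    show "- E \<in> null_sets N"
      using null_compl borel_compact[OF compact_E] by (auto simp: null_sets_def sets_N)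
    show "{w \<in> space N. \<not> (\<integral>\<^sup>+ z. f z * indicator {z. dist z w < 2 * infdist z E} z \<partial>lborel) \<le>
        ennreal (B * c1 * (36 * t * exp r) powr Q) * ennreal (dist w x powr - (2 * Q)) * indicator {w. t \<le> dist w x} w} \<subseteq> - E"
    proof (clarify)
      fix w assume "w \<in> E"
      assume n: "\<not> (\<integral>\<^sup>+ z. f z * indicator {z. dist z w < 2 * infdist z E} z \<partial>lborel) \<le>
        ennreal (B * c1 * (36 * t * exp r) powr Q) * ennreal (dist w x powr - (2 * Q)) * indicator {w. t \<le> dist w x} w"
      define Dw where "Dw = dist w x"
      have Dw: "t \<le> Dw" using infdist_le[OF \<open>w \<in> E\<close>, of x] t by (simp add: Dw_def dist_commute)
      obtain p where p: "p \<in> E" "infdist x E = dist x p" by (rule infdist_attainsE)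
      have "Dw \<le> t + \<delta>"
        using dist_triangle[of w x p] dist_le_\<delta>[OF \<open>w \<in> E\<close> p(1)] p t by (simp add: Dw_def dist_commute)
      with r have Dw2: "Dw \<le> 18 * t * exp r" by linarith
      \<comment> \<open>This is \<open>(Dw / 2)\<^sup>2 / (9 * t * exp r)\<close>, the bound that
        \<open>D\<close> gives when \<open>dist x z\<close> is at least \<open>Dw / 2\<close>. In
        the other case \<open>Dw \<le> 18 * t * exp r\<close> says exactly that
        \<open>\<rho> \<le> Dw / 2\<close>.\<close>
      define \<rho> where "\<rho> = Dw\<^sup>2 / (36 * t * exp r)"
      have \<rho>: "0 < \<rho>" using Dw t by (simp add: \<rho>_def)
      have far: "\<rho> \<le> dist z w" if "z \<in> A" for z
      proof (cases "Dw / 2 \<le> dist z w")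
        case True
        have "Dw * Dw \<le> Dw * (18 * t * exp r)" using Dw Dw2 t by (intro mult_left_mono) auto
        then have "\<rho> \<le> Dw / 2" using t by (simp add: \<rho>_def power2_eq_square field_simps)
        with True show ?thesis by simp
      next
        case False
        then have "Dw / 2 \<le> dist x z" using dist_triangle[of w x z] by (simp add: Dw_def dist_commute)
        then have "(Dw / 2)\<^sup>2 \<le> (dist x z)\<^sup>2" using Dw t by (intro power_mono) auto
        also have "\<dots> \<le> 9 * t * exp r * infdist z E" by (rule D[OF that])
        also have "\<dots> \<le> 9 * t * exp r * dist z w" using infdist_le[OF \<open>w \<in> E\<close>, of z] t by (intro mult_left_mono) auto
        finally show ?thesis using t by (simp add: \<rho>_def field_simps power2_eq_square)
      qed
      have "(\<integral>\<^sup>+ z. f z * indicator {z. dist z w < 2 * infdist z E} z \<partial>lborel)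
         \<le> (\<integral>\<^sup>+ z. ennreal B * (ennreal (dist z w powr - (DIM('a) + Q)) * indicator {z. \<rho> \<le> dist z w} z) \<partial>lborel)"
      proof (rule nn_integral_mono)
        fix z
        show "f z * indicator {z. dist z w < 2 * infdist z E} z
          \<le> ennreal B * (ennreal (dist z w powr - (DIM('a) + Q)) * indicator {z. \<rho> \<le> dist z w} z)"
        proof (cases "z \<in> A \<and> dist z w < 2 * infdist z E")
          case True
          then have zw: "0 < dist z w" using far[of z] \<rho> by linarith
          have "infdist z E powr - (DIM('a) + Q) \<le> (dist z w / 2) powr - (DIM('a) + Q)"
            using True zw Q_pos by (intro powr_mono2') auto
          also have "\<dots> = 2 powr (DIM('a) + Q) * dist z w powr - (DIM('a) + Q)"
            by (rule powr_minus_half) simp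
          finally have "infdist z E powr - (DIM('a) + Q) / \<alpha> \<le> B * dist z w powr - (DIM('a) + Q)"
            using \<alpha>_pos by (simp add: B_def divide_right_mono)
          then have "f z \<le> ennreal (B * dist z w powr - (DIM('a) + Q))"
            using True by (simp add: f_def ennreal_leI)
          also have "\<dots> = ennreal B * ennreal (dist z w powr - (DIM('a) + Q))"
            using c by (intro ennreal_mult) auto
          finally show ?thesis using True far[of z] by simp
        qed (auto simp: f_def)
      qed
      also have "\<dots> = ennreal B * (\<integral>\<^sup>+ z \<in> {z. \<rho> \<le> dist z w}. ennreal (dist z w powr - (DIM('a) + Q)) \<partial>lborel)"
        by (rule nn_integral_cmult) measurable
      also have "\<dots> \<le> ennreal B * ennreal (c1 * \<rho> powr - Q)"
        using nn_integral_powr_shell_lborel[OF \<rho>, of "DIM('a) + Q" w] Q_pos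
        by (intro mult_left_mono) (auto simp: c1_def)
      also have "\<dots> = ennreal (B * c1 * \<rho> powr - Q)"
        using c by (simp add: ennreal_mult mult.assoc)
      also have "\<rho> powr - Q = (36 * t * exp r) powr Q * Dw powr - (2 * Q)"
      proof -
        have "Dw\<^sup>2 powr - Q = Dw powr - (2 * Q)"
          using Dw t powr_powr[of Dw 2 "- Q"] by simp
        then show ?thesis
          using t Dw unfolding \<rho>_def by (subst powr_divide) (auto simp: powr_minus_divide)
      qed
      also have "ennreal (B * c1 * ((36 * t * exp r) powr Q * Dw powr - (2 * Q))) =
         ennreal (B * c1 * (36 * t * exp r) powr Q) * ennreal (Dw powr - (2 * Q))"
        unfolding mult.assoc[symmetric] using c by (intro ennreal_mult) auto
      finally show False using n Dw by (simp add: Dw_def)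
    qed
  qed
  also have "\<dots> = ennreal (B * c1 * (36 * t * exp r) powr Q) * (\<integral>\<^sup>+ w \<in> {w. t \<le> dist w x}. ennreal (dist w x powr - (2 * Q)) \<partial>N)"
    unfolding mult.assoc by (rule nn_integral_cmult) measurable
  also have "\<dots> \<le> ennreal (B * c1 * (36 * t * exp r) powr Q) * ennreal (c2 * t powr - Q)"
    using nn_integral_powr_shell[OF sets_N, of Q "2 * Q" t "\<beta> * 8 ^ DIM('a) * 2 powr Q" x] emeasure_ball_le_any Q_pos t \<beta>_pos
    by (intro mult_left_mono) (auto simp: c2_def)
  also have "\<dots> = ennreal (B * c1 * (36 * t * exp r) powr Q * (c2 * t powr - Q))"
    using c by (intro ennreal_mult[symmetric]) auto
  also have "B * c1 * (36 * t * exp r) powr Q * (c2 * t powr - Q) = B * c1 * c2 * 36 powr Q * exp (Q * r)"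
    using t by (simp add: powr_mult powr_minus_divide exp_powr_real mult.commute)
  finally show ?thesis by (simp only: B_def c1_def c2_def)
qed

text \<open>The integral of \<open>d powr - n\<close> away from \<open>E\<close> diverges only logarithmically, so giving up a factor
  \<open>H powr (Q/2)\<close> makes it converge; there \<open>H\<close> is of order \<open>t * exp r\<close>.\<close>

lemma qh_volume_far_le:
  assumes A [measurable]: "A \<in> sets borel" and H: "0 < H"
    and d: "\<And>z. z \<in> A \<Longrightarrow> \<delta> \<le> infdist z E" "\<And>z. z \<in> A \<Longrightarrow> infdist z E \<le> H"
  shows "(\<integral>\<^sup>+ z \<in> A. ennreal (1 / infdist z E ^ DIM('a)) \<partial>lborel) \<le>
     ennreal (2 powr (DIM('a) + Q/2) * (unit_ball_vol DIM('a) * 2 powr DIM('a) / (1 - 2 powr - (Q/2)))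
        * \<delta> powr - (Q/2) * H powr (Q/2))"
proof -
  define c where "c = unit_ball_vol DIM('a) * 2 powr DIM('a) / (1 - 2 powr - (Q/2))"
  define B where "B = 2 powr (DIM('a) + Q/2) * H powr (Q/2)"
  have B: "0 \<le> B" by (simp add: B_def)
  obtain w where w: "w \<in> E" using E_nonempty by blast
  have "(\<integral>\<^sup>+ z \<in> A. ennreal (1 / infdist z E ^ DIM('a)) \<partial>lborel) \<le>
     (\<integral>\<^sup>+ z. ennreal B * (ennreal (dist z w powr - (DIM('a) + Q/2)) * indicator {z. \<delta> \<le> dist z w} z) \<partial>lborel)"
  proof (rule nn_integral_mono)
    fix z
    let ?d = "infdist z E"
    show "ennreal (1 / ?d ^ DIM('a)) * indicator A z
      \<le> ennreal B * (ennreal (dist z w powr - (DIM('a) + Q/2)) * indicator {z. \<delta> \<le> dist z w} z)"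
    proof (cases "z \<in> A")
      case True
      have dz: "\<delta> \<le> ?d" "?d \<le> H" "0 < ?d" using d[OF True] diam_pos by auto
      obtain p where p: "p \<in> E" "?d = dist z p" by (rule infdist_attainsE)
      have zw: "\<delta> \<le> dist z w" using dz infdist_le[OF w, of z] by simp
      \<comment> \<open>At distance at least \<open>\<delta>\<close> the set \<open>E\<close>
        behaves like a single point: any fixed \<open>w\<close> in \<open>E\<close> satisfies
        \<open>dist z w \<le> infdist z E + \<delta> \<le> 2 * infdist z E\<close>.\<close>
      have zw2: "dist z w / 2 \<le> ?d" using dist_triangle[of z w p] dist_le_\<delta>[OF p(1) w] p dz by simp
      have "1 / ?d ^ DIM('a) = ?d powr - (DIM('a) + Q/2) * ?d powr (Q/2)"
        using dz by (simp add: powr_minus_divide powr_realpow flip: powr_add)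
      also have "\<dots> \<le> (dist z w / 2) powr - (DIM('a) + Q/2) * H powr (Q/2)"
        using dz zw zw2 diam_pos Q_pos by (intro mult_mono powr_mono2' powr_mono2) auto
      also have "\<dots> = B * dist z w powr - (DIM('a) + Q/2)"
        by (simp only: powr_minus_half zero_le_dist B_def mult_ac)
      finally have "ennreal (1 / ?d ^ DIM('a)) \<le> ennreal (B * dist z w powr - (DIM('a) + Q/2))" by (rule ennreal_leI)
      also have "\<dots> = ennreal B * ennreal (dist z w powr - (DIM('a) + Q/2))" using B by (intro ennreal_mult) auto
      finally show ?thesis using True zw by simp
    qed simp
  qed
  also have "\<dots> = ennreal B * (\<integral>\<^sup>+ z \<in> {z. \<delta> \<le> dist z w}. ennreal (dist z w powr - (DIM('a) + Q/2)) \<partial>lborel)"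
    by (rule nn_integral_cmult) measurable
  also have "\<dots> \<le> ennreal B * ennreal (c * \<delta> powr - (Q/2))"
    using nn_integral_powr_shell_lborel[OF diam_pos, of "DIM('a) + Q/2" w] Q_pos
    by (intro mult_left_mono) (auto simp: c_def)
  also have "\<dots> = ennreal (B * (c * \<delta> powr - (Q/2)))"
    using B Q_pos by (intro ennreal_mult[symmetric]) (auto simp: c_def powr_less_one less_imp_le)
  finally show ?thesis by (simp add: B_def c_def mult_ac)
qed

lemma qh_volume_le:
  assumes x: "x \<notin> E" and t: "t = infdist x E" and r: "0 \<le> r" "t + \<delta> \<le> 18 * t * exp r" "4 * t \<le> exp r"
  shows "qh_volume (- E) (qh_ball (- E) x r) \<le> ennreal (upper_const DIM('a) Q \<alpha> \<beta> \<delta> * exp (Q * r))"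
proof -
  have cl: "closed E" by (rule compact_imp_closed[OF compact_E])
  have t0: "0 < t"
    using x in_closed_iff_infdist_zero[OF cl E_nonempty, of x] infdist_nonneg[of x E] by (simp add: t less_le)
  \<comment> \<open>The ball is enlarged to the Borel set cut out by the conclusions of
    \<open>qh_ball_bounds\<close>, which is then split at distance \<open>\<delta>\<close> from
    \<open>E\<close>.\<close>
  define A where "A = {z. 0 < infdist z E \<and> (dist x z)\<^sup>2 \<le> 9 * t * exp r * infdist z E \<and> infdist z E \<le> t + 3 * t * exp r}"
  have [measurable]: "A \<in> sets borel" unfolding A_def by measurable
  have sub: "qh_ball (- E) x r \<subseteq> A" using qh_ball_bounds[OF x t] by (auto simp: A_def)
  define A1 where "A1 = A \<inter> nbhd \<delta>"
  define A2 where "A2 = A - nbhd \<delta>"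
  have [measurable]: "A1 \<in> sets borel" "A2 \<in> sets borel" unfolding A1_def A2_def by auto
  define U1 where "U1 = 2 powr (DIM('a) + Q) / \<alpha> * (unit_ball_vol DIM('a) * 2 powr DIM('a) / (1 - 2 powr - Q))
       * (\<beta> * 8 ^ DIM('a) * 2 powr Q * 2 powr Q / (1 - 2 powr - Q)) * 36 powr Q"
  define U2 where "U2 = 2 powr (DIM('a) + Q/2) * (unit_ball_vol DIM('a) * 2 powr DIM('a) / (1 - 2 powr - (Q/2))) * \<delta> powr - (Q/2)"
  have U: "0 \<le> U1" "0 \<le> U2"
    using \<alpha>_pos \<beta>_pos Q_pos by (auto simp: U1_def U2_def powr_less_one less_imp_le)
  have "qh_volume (- E) (qh_ball (- E) x r) \<le> (\<integral>\<^sup>+ z \<in> A. ennreal (1 / infdist z E ^ DIM('a)) \<partial>lebesgue)"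
    unfolding qh_volume_def bdist_compl using sub by (intro nn_integral_mono) (auto simp: indicator_def)
  also have "\<dots> = (\<integral>\<^sup>+ z \<in> A. ennreal (1 / infdist z E ^ DIM('a)) \<partial>lborel)"
    by (rule nn_integral_indicator_lebesgue) measurable
  also have "\<dots> = (\<integral>\<^sup>+ z. ennreal (1 / infdist z E ^ DIM('a)) * indicator A1 z + ennreal (1 / infdist z E ^ DIM('a)) * indicator A2 z \<partial>lborel)"
    by (intro nn_integral_cong) (auto simp: A1_def A2_def indicator_def)
  also have "\<dots> = (\<integral>\<^sup>+ z \<in> A1. ennreal (1 / infdist z E ^ DIM('a)) \<partial>lborel) + (\<integral>\<^sup>+ z \<in> A2. ennreal (1 / infdist z E ^ DIM('a)) \<partial>lborel)"
    by (rule nn_integral_add) measurable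
  also have "\<dots> \<le> ennreal (U1 * exp (Q * r)) + ennreal (U2 * exp (Q * r))"
  proof (rule add_mono)
    show "(\<integral>\<^sup>+ z \<in> A1. ennreal (1 / infdist z E ^ DIM('a)) \<partial>lborel) \<le> ennreal (U1 * exp (Q * r))"
      unfolding U1_def by (rule qh_volume_near_le[OF t0 t r(2)]) (auto simp: A1_def A_def)
    have "t * 1 \<le> t * exp r" using t0 r by (intro mult_left_mono) auto
    then have le: "infdist z E \<le> 4 * t * exp r" if "z \<in> A2" for z
      using that by (auto simp: A2_def A_def)
    \<comment> \<open>Here \<open>H = 4 * t * exp r\<close>, which is at most
      \<open>exp (2 * r)\<close> once \<open>4 * t \<le> exp r\<close>. The exponent
      \<open>Q/2\<close> then yields \<open>exp (Q * r)\<close> with a constant free of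
      \<open>t\<close>.\<close>
    have "(\<integral>\<^sup>+ z \<in> A2. ennreal (1 / infdist z E ^ DIM('a)) \<partial>lborel) \<le> ennreal (U2 * (4 * t * exp r) powr (Q/2))"
      unfolding U2_def using t0 le by (intro qh_volume_far_le) (auto simp: A2_def)
    also have "\<dots> \<le> ennreal (U2 * exp (Q * r))"
    proof (intro ennreal_leI mult_left_mono U)
      have "(4 * t * exp r) powr (Q/2) \<le> (exp r * exp r) powr (Q/2)"
        using t0 r Q_pos by (intro powr_mono2 mult_right_mono) auto
      also have "\<dots> = exp (Q * r)" by (simp add: exp_powr_real mult.commute flip: exp_add)
      finally show "(4 * t * exp r) powr (Q/2) \<le> exp (Q * r)" .
    qed
    finally show "(\<integral>\<^sup>+ z \<in> A2. ennreal (1 / infdist z E ^ DIM('a)) \<partial>lborel) \<le> ennreal (U2 * exp (Q * r))" .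
  qed
  also have "\<dots> = ennreal (upper_const DIM('a) Q \<alpha> \<beta> \<delta> * exp (Q * r))"
  proof -
    have "upper_const DIM('a) Q \<alpha> \<beta> \<delta> = U1 + U2" by (simp only: upper_const_def U1_def U2_def of_nat_id)
    then show ?thesis using U by (simp add: distrib_right)
  qed
  finally show ?thesis .
qed

end

text \<open>Quantifying \<open>C\<close> and \<open>c\<close> before \<open>E\<close> expresses that
  they depend on the data alone; \<open>c\<close> is a function so that it may also depend on the
  boundary distance of \<open>x\<close>. The witnesses are \<open>upper_const\<close> and
  \<open>lower_const\<close>.\<close>

theorem corollary5p10:
  fixes Q \<alpha> \<beta> \<delta> L :: real
  assumes "CARD('n::finite) \<ge> 2"
    and "0 < Q" and "Q < real CARD('n)" and "0 < \<alpha>" and "\<alpha> \<le> \<beta>" and "0 < \<delta>" and "1 < L"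
  shows "\<exists>(C::real) (c::real \<Rightarrow> real). (\<forall>t>0. c t > 0) \<and>
    (\<forall>E :: (real ^ 'n) set.
       compact E \<longrightarrow> regular_set Q \<alpha> \<beta> E \<longrightarrow> diameter E = \<delta> \<longrightarrow> uniform_domain L (- E) \<longrightarrow>
       (\<forall>x \<in> - E. \<forall>\<^sub>F r in at_top.
          ennreal (c (bdist (- E) x) * exp (Q * r / L)) \<le> qh_volume (- E) (qh_ball (- E) x r) \<and>
          qh_volume (- E) (qh_ball (- E) x r) \<le> ennreal (C * exp (Q * r))))"
proof (intro exI conjI allI impI ballI)
  fix t :: real assume "0 < t"
  then show "0 < lower_const CARD('n) Q \<alpha> \<beta> \<delta> t"
    using assms by (simp add: lower_const_def shell_ratio_def)
next
  fix E :: "(real ^ 'n) set" and x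
  assume E: "compact E" "regular_set Q \<alpha> \<beta> E" "diameter E = \<delta>" "uniform_domain L (- E)" and x: "x \<in> - E"
  obtain N :: "(real ^ 'n) measure" where N: "sets N = sets borel" "emeasure N (- E) = 0"
    "\<And>x r. x \<in> E \<Longrightarrow> 0 < r \<Longrightarrow> r < diameter E \<Longrightarrow> ennreal (\<alpha> * r powr Q) \<le> emeasure N (ball x r)"
    "\<And>x r. x \<in> E \<Longrightarrow> 0 < r \<Longrightarrow> r < diameter E \<Longrightarrow> emeasure N (ball x r) \<le> ennreal (\<beta> * r powr Q)"
    using regular_setE[OF E(2) compact_imp_bounded[OF E(1)]] by metis
  interpret ahlfors_regular_measure N E Q \<alpha> \<beta> \<delta>
    by unfold_locales (use assms E N[unfolded E(3)] in \<open>(assumption | simp)\<close>)+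
  define t where "t = infdist x E"
  have t: "0 < t"
    using x in_closed_iff_infdist_zero[OF compact_imp_closed[OF E(1)] E_nonempty, of x] infdist_nonneg[of x E]
    by (simp add: t_def less_le)
  have top: "filterlim (\<lambda>r. exp r :: real) at_top at_top" by (rule exp_at_top)
  have "filterlim (\<lambda>r. r / L) at_top at_top"
    using assms by real_asymp
  then have topL: "filterlim (\<lambda>r. exp (r / L)) at_top at_top"
    by (rule filterlim_compose[OF exp_at_top])
  have lim0: "((\<lambda>r. a * exp (- r / L)) \<longlongrightarrow> 0) at_top" for a
    using assms by real_asymp
  \<comment> \<open>What follows are the conditions on \<open>r\<close> in
    \<open>qh_volume_ge\<close> and \<open>qh_volume_le\<close>, each true for all large
    \<open>r\<close>.\<close>
  have "\<forall>\<^sub>F r in at_top. 2 < exp (r / L)" using topL by (simp add: filterlim_at_top_dense)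
  moreover have "\<forall>\<^sub>F r in at_top. 2 * (t + 2 * \<delta>) * exp (- r / L) < t"
    using lim0 t by (rule order_tendstoD)
  moreover have "\<forall>\<^sub>F r in at_top. shell_ratio CARD('n) Q \<alpha> \<beta> * (2 * (t + 2 * \<delta>)) * exp (- r / L) < \<delta>"
    using lim0 assms(6) by (rule order_tendstoD)
  moreover have "\<forall>\<^sub>F r in at_top. (t + \<delta>) / (18 * t) \<le> exp r" "\<forall>\<^sub>F r in at_top. 4 * t \<le> exp r"
    using top by (simp_all add: filterlim_at_top)
  moreover note eventually_ge_at_top[of "0::real"]
  ultimately show "\<forall>\<^sub>F r in at_top.
          ennreal (lower_const CARD('n) Q \<alpha> \<beta> \<delta> (bdist (- E) x) * exp (Q * r / L)) \<le> qh_volume (- E) (qh_ball (- E) x r) \<and>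
          qh_volume (- E) (qh_ball (- E) x r) \<le> ennreal (upper_const CARD('n) Q \<alpha> \<beta> \<delta> * exp (Q * r))"
  proof eventually_elim
    case (elim r)
    then have "t + \<delta> \<le> 18 * t * exp r" using t by (simp add: field_simps)
    with elim show ?case
      using qh_volume_ge[OF refl E(4) _ t_def, of r] qh_volume_le[OF _ t_def, of r] x
      by (simp add: bdist_compl t_def[symmetric] mult.assoc)
  qed
qed

end
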